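(* Fix $0<\kappa\le\frac12$. In the setting described in the context, consider for $A:B_{n_0}(\eta)\to\mathbb M_{n_0\times n_0}(\mathbb R)$ the equation, in polar coordinates $u=r\omega$, $$\partial_r\big(rA(r\omega)\big)=-A(r\omega)^2-C_u(r\omega)A(r\omega)-C_u(r\omega).$$ There exists an admissible constant $\eta_1=\eta_1(\kappa)>0$ such that there is a unique solution $A\in C(B_{n_0}(\eta_1);\mathbb M_{n_0\times n_0}(\mathbb R))$ satisfying $A(r\omega)=O(r)$ for each fixed $\omega$. This solution satisfies $\|A(t)\|\lesssim|t|$ and $\sup_{t\in B_{n_0}(\eta_1)}\|A(t)\|\le\kappa$. Furthermore, if $\tilde c^k_{i,j}\in C^m(B_{n_0}(\eta_1))$ with $\|\tilde c^k_{i,j}\|_{C^m(B_{n_0}(\eta_1))}\le\widetilde C_{m,\eta_1}<\infty$ for all $1\le i,j,k\le n_0$, then $A\in C^m$ and $\|A\|_{C^m(B_{n_0}(\eta_1);\mathbb M_{n_0\times n_0}(\mathbb R))}\le C_m$, where $C_m=C_m(m,\widetilde C_{m,\eta_1})$ is an admissible constant (allowed also to depend on $m$ and $\widetilde C_{m,\eta_1}$).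
   Context: Setting: $\Omega\subseteq\mathbb R^n$ connected open; $X_1,\dots,X_{n_0}$ $C^1$ vector fields on $\Omega$ with degrees $d_j\in(0,\infty)$; $\xi\in(0,1]$, $x_0\in\Omega$, $(X,d)$ satisfies $\mathcal C(x_0,\xi)$; on $B=B_{(X,d)}(x_0,\xi)$, $[X_j,X_k]=\sum_{l=1}^{n_0}c^l_{j,k}X_l$; $X_1(x_0),\dots,X_{n_0}(x_0)$ linearly independent; $\|X_j\|_{C^1(B)}<\infty$; $\sum_{|\alpha|\le2}\|X^\alpha c^l_{j,k}\|_{C^0(B)}<\infty$ (derivatives continuous). Here $B_{(X,d)}(x_0,\xi)$ is the set of $\gamma(1)$ over paths $\gamma:[0,1]\to\Omega$, $\gamma(t)=x_0+\int_0^t\sum a_j\xi^{d_j}X_j(\gamma)$, $\|(\sum|a_j|^2)^{1/2}\|_\infty<1$; $\mathcal C(x_0,\xi)$ means all such paths exist in $\Omega$. $\Phi(u)=e^{u_1X_1+\cdots+u_{n_0}X_{n_0}}x_0$ (time-one flow), defined on $B_{n_0}(\eta)$ for a sufficiently small admissible $\eta>0$. Define $\tilde c^k_{i,j}(u)=c^k_{i,j}(\Phi(u))$ and the $n_0\times n_0$ matrix $C_u$ by $(C_u)_{i,k}(u)=\sum_{j=1}^{n_0}u_j\tilde c^k_{i,j}(u)$. $\|\cdot\|$ is the operator norm. Admissible constants depend only on upper and positive lower bounds for the $d_j$, an upper bound for $n$, a positive lower bound for $\xi$, and upper bounds for $\|X_j\|_{C^1(B)}$ and $\sum_{|\alpha|\le2}\|X^\alpha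 c^l_{j,k}\|_{C^0(B)}$; $\lesssim$ is up to admissible constants. $\|f\|_{C^m(U)}=\sup_U\sum_{|\beta|\le m}|\partial^\beta f|$. *)

theory Defs
  imports "HOL-Analysis.Analysis"
begin

text \<open>Vector fields X j (j ranging over the finite index type 'k, so n0 = CARD('k))
on Omega, a subset of real^'n.  A control is a measurable a : [0,1] -> R^n0 with
sup-norm of the Euclidean norm strictly less than 1.\<close>

definition adm_ctrl :: "(real \<Rightarrow> real^'k) \<Rightarrow> bool" where
  "adm_ctrl a \<longleftrightarrow> a measurable_on {0..1} \<and> (\<exists>c<1. \<forall>t\<in>{0..1}. norm (a t) \<le> c)"

definition ctrl_path ::
  "(real^'n) set \<Rightarrow> ('k::finite \<Rightarrow> real^'n \<Rightarrow> real^'n) \<Rightarrow> ('k \<Rightarrow> real) \<Rightarrow> real \<Rightarrow> real^'n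
   \<Rightarrow> (real \<Rightarrow> real^'k) \<Rightarrow> (real \<Rightarrow> real^'n) \<Rightarrow> bool" where
  "ctrl_path \<Omega> X d \<xi> x0 a \<gamma> \<longleftrightarrow> \<gamma> ` {0..1} \<subseteq> \<Omega> \<and>
     (\<forall>t\<in>{0..1}. ((\<lambda>s. \<Sum>j\<in>UNIV. (a s $ j * \<xi> powr d j) *\<^sub>R X j (\<gamma> s))
                    has_integral (\<gamma> t - x0)) {0..t})"

definition ballXd ::
  "(real^'n) set \<Rightarrow> ('k::finite \<Rightarrow> real^'n \<Rightarrow> real^'n) \<Rightarrow> ('k \<Rightarrow> real) \<Rightarrow> real \<Rightarrow> real^'n
   \<Rightarrow> (real^'n) set" where
  "ballXd \<Omega> X d \<xi> x0 = {\<gamma> 1 | \<gamma> a. adm_ctrl a \<and> ctrl_path \<Omega> X d \<xi> x0 a \<gamma>}"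

definition condC ::
  "(real^'n) set \<Rightarrow> ('k::finite \<Rightarrow> real^'n \<Rightarrow> real^'n) \<Rightarrow> ('k \<Rightarrow> real) \<Rightarrow> real \<Rightarrow> real^'n \<Rightarrow> bool" where
  "condC \<Omega> X d \<xi> x0 \<longleftrightarrow> (\<forall>a. adm_ctrl a \<longrightarrow> (\<exists>\<gamma>. ctrl_path \<Omega> X d \<xi> x0 a \<gamma>))"

definition has_lie_deriv ::
  "(real^'n \<Rightarrow> real^'n) \<Rightarrow> (real^'n \<Rightarrow> real) \<Rightarrow> (real^'n) set \<Rightarrow> real^'n \<Rightarrow> real \<Rightarrow> bool" where
  "has_lie_deriv V f S x L \<longleftrightarrow>
     (\<exists>e>0. \<exists>\<gamma>. \<gamma> 0 = x \<and>
        (\<forall>t\<in>{-e<..<e}. \<gamma> t \<in> S \<and> (\<gamma> has_vector_derivative V (\<gamma> t)) (at t)) \<and>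
        ((\<lambda>t. f (\<gamma> t)) has_real_derivative L) (at 0))"

definition lie_deriv ::
  "(real^'n \<Rightarrow> real^'n) \<Rightarrow> (real^'n \<Rightarrow> real) \<Rightarrow> (real^'n) set \<Rightarrow> real^'n \<Rightarrow> real" where
  "lie_deriv V f S x = (THE L. has_lie_deriv V f S x L)"

definition Phi ::
  "(real^'n) set \<Rightarrow> ('k::finite \<Rightarrow> real^'n \<Rightarrow> real^'n) \<Rightarrow> real^'n \<Rightarrow> real^'k \<Rightarrow> real^'n" where
  "Phi \<Omega> X x0 u = (THE y. \<exists>\<gamma>. \<gamma> 0 = x0 \<and> \<gamma> 1 = y \<and> \<gamma> ` {0..1} \<subseteq> \<Omega> \<and>
      (\<forall>t\<in>{0..1}. (\<gamma> has_vector_derivative (\<Sum>j\<in>UNIV. u $ j *\<^sub>R X j (\<gamma> t))) (at t within {0..1})))"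

text \<open>c i j k x stands for c^k_{i,j}(x).  ctilde i j k u = c^k_{i,j}(Phi u).\<close>

definition ctilde ::
  "(real^'n) set \<Rightarrow> ('k::finite \<Rightarrow> real^'n \<Rightarrow> real^'n) \<Rightarrow> real^'n
   \<Rightarrow> ('k \<Rightarrow> 'k \<Rightarrow> 'k \<Rightarrow> real^'n \<Rightarrow> real) \<Rightarrow> 'k \<Rightarrow> 'k \<Rightarrow> 'k \<Rightarrow> real^'k \<Rightarrow> real" where
  "ctilde \<Omega> X x0 c i j k u = c i j k (Phi \<Omega> X x0 u)"

definition Cmat ::
  "(real^'n) set \<Rightarrow> ('k::finite \<Rightarrow> real^'n \<Rightarrow> real^'n) \<Rightarrow> real^'n
   \<Rightarrow> ('k \<Rightarrow> 'k \<Rightarrow> 'k \<Rightarrow> real^'n \<Rightarrow> real) \<Rightarrow> real^'k \<Rightarrow> real^'k^'k" where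
  "Cmat \<Omega> X x0 c u = (\<chi> i k. \<Sum>j\<in>UNIV. u $ j * ctilde \<Omega> X x0 c i j k u)"

definition opnorm :: "real^'k^'k \<Rightarrow> real" where
  "opnorm M = onorm (\<lambda>v. M *v v)"

definition setting ::
  "(real^'n) set \<Rightarrow> ('k::finite \<Rightarrow> real^'n \<Rightarrow> real^'n) \<Rightarrow> ('k \<Rightarrow> real) \<Rightarrow> real \<Rightarrow> real^'n
   \<Rightarrow> ('k \<Rightarrow> 'k \<Rightarrow> 'k \<Rightarrow> real^'n \<Rightarrow> real)
   \<Rightarrow> real \<Rightarrow> real \<Rightarrow> real \<Rightarrow> real \<Rightarrow> real \<Rightarrow> bool" where
  "setting \<Omega> X d \<xi> x0 c dmin dmax ximin CX Cc \<longleftrightarrow>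
     open \<Omega> \<and> connected \<Omega> \<and>
     \<comment> \<open>C^1 vector fields on Omega\<close>
     (\<forall>j. (\<forall>x\<in>\<Omega>. X j differentiable (at x)) \<and>
          continuous_on \<Omega> (\<lambda>x. frechet_derivative (X j) (at x))) \<and>
     \<comment> \<open>degrees with upper and positive lower bounds\<close>
     (\<forall>j. dmin \<le> d j \<and> d j \<le> dmax) \<and>
     ximin \<le> \<xi> \<and> 0 < \<xi> \<and> \<xi> \<le> 1 \<and>
     x0 \<in> \<Omega> \<and> condC \<Omega> X d \<xi> x0 \<and>
     (let B = ballXd \<Omega> X d \<xi> x0 in
       \<comment> \<open>commutator relations [X_j,X_k] = sum_l c^l_{j,k} X_l on B\<close>
       (\<forall>x\<in>B. \<forall>j k. frechet_derivative (X k) (at x) (X j x) - frechet_derivative (X j) (at x) (X k x)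
                     = (\<Sum>l\<in>UNIV. c j k l x *\<^sub>R X l x)) \<and>
       \<comment> \<open>linear independence of X_1(x0),...,X_n0(x0)\<close>
       (\<forall>a::real^'k. (\<Sum>j\<in>UNIV. a $ j *\<^sub>R X j x0) = 0 \<longrightarrow> a = 0) \<and>
       \<comment> \<open>C^1(B) bounds for X_j\<close>
       (\<forall>j. \<forall>x\<in>B. norm (X j x) \<le> CX \<and> onorm (frechet_derivative (X j) (at x)) \<le> CX) \<and>
       \<comment> \<open>X^alpha c^l_{j,k} exist, are continuous on B and bounded, |alpha| <= 2\<close>
       (\<forall>j k l. continuous_on B (c j k l) \<and> (\<forall>x\<in>B. \<bar>c j k l x\<bar> \<le> Cc) \<and>
          (\<forall>i. (\<forall>x\<in>B. \<exists>L. has_lie_deriv (X i) (c j k l) B x L) \<and>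
               continuous_on B (lie_deriv (X i) (c j k l) B) \<and>
               (\<forall>x\<in>B. \<bar>lie_deriv (X i) (c j k l) B x\<bar> \<le> Cc)) \<and>
          (\<forall>i i'. (\<forall>x\<in>B. \<exists>L. has_lie_deriv (X i) (lie_deriv (X i') (c j k l) B) B x L) \<and>
               continuous_on B (lie_deriv (X i) (lie_deriv (X i') (c j k l) B) B) \<and>
               (\<forall>x\<in>B. \<bar>lie_deriv (X i) (lie_deriv (X i') (c j k l) B) B x\<bar> \<le> Cc))))"

definition is_sol ::
  "real \<Rightarrow> (real^'n) set \<Rightarrow> ('k::finite \<Rightarrow> real^'n \<Rightarrow> real^'n) \<Rightarrow> real^'n
   \<Rightarrow> ('k \<Rightarrow> 'k \<Rightarrow> 'k \<Rightarrow> real^'n \<Rightarrow> real) \<Rightarrow> (real^'k \<Rightarrow> real^'k^'k) \<Rightarrow> bool" where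
  "is_sol \<eta> \<Omega> X x0 c A \<longleftrightarrow>
     continuous_on (ball 0 \<eta>) A \<and>
     (\<forall>\<omega>::real^'k. norm \<omega> = 1 \<longrightarrow>
        (\<forall>r\<in>{0<..<\<eta>}.
           ((\<lambda>s. s *\<^sub>R A (s *\<^sub>R \<omega>)) has_vector_derivative
              (- (A (r *\<^sub>R \<omega>) ** A (r *\<^sub>R \<omega>)) - Cmat \<Omega> X x0 c (r *\<^sub>R \<omega>) ** A (r *\<^sub>R \<omega>)
               - Cmat \<Omega> X x0 c (r *\<^sub>R \<omega>))) (at r)) \<and>
        (\<exists>K \<delta>. \<delta> > 0 \<and> (\<forall>r\<in>{0<..<\<delta>}. opnorm (A (r *\<^sub>R \<omega>)) \<le> K * r)))"

fun pderivs :: "'k::finite list \<Rightarrow> (real^'k \<Rightarrow> real) \<Rightarrow> real^'k \<Rightarrow> real" where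
  "pderivs [] f = f"
| "pderivs (i # is) f = (\<lambda>x. deriv (\<lambda>t. pderivs is f (x + t *\<^sub>R axis i 1)) 0)"

definition is_Cm :: "nat \<Rightarrow> (real^'k::finite \<Rightarrow> real) \<Rightarrow> (real^'k) set \<Rightarrow> bool" where
  "is_Cm m f U \<longleftrightarrow>
     (\<forall>\<beta>. length \<beta> \<le> m \<longrightarrow> continuous_on U (pderivs \<beta> f)) \<and>
     (\<forall>\<beta>. length \<beta> < m \<longrightarrow>
        (\<forall>x\<in>U. \<forall>i. (\<lambda>t. pderivs \<beta> f (x + t *\<^sub>R axis i 1)) differentiable (at 0)))"

definition Cm_norm_le :: "nat \<Rightarrow> (real^'k::finite \<Rightarrow> real) \<Rightarrow> (real^'k) set \<Rightarrow> real \<Rightarrow> bool" where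
  "Cm_norm_le m f U C \<longleftrightarrow> (\<forall>x\<in>U. (\<Sum>\<beta>\<in>{\<beta>. length \<beta> \<le> m}. \<bar>pderivs \<beta> f x\<bar>) \<le> C)"

definition Cm_norm_le_mat :: "nat \<Rightarrow> (real^'k::finite \<Rightarrow> real^'k^'k) \<Rightarrow> (real^'k) set \<Rightarrow> real \<Rightarrow> bool" where
  "Cm_norm_le_mat m A U C \<longleftrightarrow>
     (\<forall>x\<in>U. (\<Sum>\<beta>\<in>{\<beta>. length \<beta> \<le> m}. \<Sum>i\<in>UNIV. \<Sum>j\<in>UNIV. \<bar>pderivs \<beta> (\<lambda>u. A u $ i $ j) x\<bar>) \<le> C)"

end

theory Submission
  imports Defs
begin

text \<open>In integrated form the equation reads \<open>A u = - \<integral>\<^sub>0\<^sup>1 (A\<^sup>2 + C A + C) (s u) ds\<close>. As \<open>C u = O(|u|)\<close>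
  with an admissible constant, Picard iteration contracts on small matrix-valued functions on a small
  ball. Uniqueness follows from Gronwall's inequality along rays, and continuity of \<open>C\<close> from continuous
  dependence of the flow on its parameters.

  For regularity, a partial derivative of \<open>A\<close> formally solves the \<^emph>\<open>linear\<close> equation of the same kind,
  with weight \<open>s\<close> instead of \<open>1\<close> and coefficients built from \<open>A\<close>, \<open>C\<close> and the derivative of \<open>C\<close>. Its
  contraction constant is that of the linearisation, so the same ball works for every order. Hence
  the induction on \<open>m\<close> runs over quadratic equations with arbitrary weights \<open>s\<^sup>p\<close>, linear ones included.\<close>

section \<open>Averages along rays\<close>

text \<open>The radial equation is singular at \<open>r = 0\<close>: only \<open>r A\<close> is
  differentiated, so prescribing a value of \<open>A\<close> there is no initial condition of the
  usual kind. For C = 0 the constant \<open>A = -I\<close> is a second continuous solution beside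
  \<open>A = 0\<close>; the requirement O(r), and in the existence part the smallness of
  \<open>A\<close>, select the right one.

  For regularity the radius is fixed before \<open>m\<close>, so no smallness can be spent anew on
  each derivative. Two facts make this possible: averaging with any weight \<open>s ^ p\<close> has
  norm at most 1, and a linear equation needs a small coefficient but no small solution. A further
  point is that the derivative of \<open>A\<close> is not known to exist beforehand. A candidate is
  therefore constructed as the solution of the linear equation, and the derivatives of the Picard
  iterates are shown to converge to it uniformly.

  Admissibility of constants is a matter of quantifier order: each constant is obtained before the
  domain, the fields and the structure functions are fixed.\<close>

definition star_at_0 :: "'a::real_vector set \<Rightarrow> bool" where
  "star_at_0 U \<longleftrightarrow> (\<forall>u\<in>U. \<forall>s\<in>{0..1}. s *\<^sub>R u \<in> U)"

lemma star_at_0_ball: "star_at_0 (ball (0::'a::real_normed_vector) r)"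
  and star_at_0_cball: "star_at_0 (cball (0::'a::real_normed_vector) r)"
  unfolding star_at_0_def
  by (auto intro: le_less_trans[OF mult_left_le_one_le[OF norm_ge_zero]] order_trans[OF mult_left_le_one_le[OF norm_ge_zero]])

definition ray_avg :: "nat \<Rightarrow> ('a::real_normed_vector \<Rightarrow> 'b::banach) \<Rightarrow> 'a \<Rightarrow> 'b" where
  "ray_avg p f u = integral {0..1} (\<lambda>s. s ^ p *\<^sub>R f (s *\<^sub>R u))"

lemma continuous_on_ray:
  fixes U :: "'a::real_normed_vector set"
  assumes "star_at_0 U" "continuous_on U f" "u \<in> U"
  shows "continuous_on {0..1} (\<lambda>s. f (s *\<^sub>R u))"
  by (rule continuous_on_compose2[OF assms(2)])
     (use assms(1,3) in \<open>auto intro!: continuous_intros simp: star_at_0_def\<close>)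

lemma has_integral_ray_avg:
  assumes "star_at_0 U" "continuous_on U f" "u \<in> U"
  shows "((\<lambda>s. s ^ p *\<^sub>R f (s *\<^sub>R u)) has_integral ray_avg p f u) {0..1}"
  unfolding ray_avg_def
  by (intro integrable_integral integrable_continuous_real continuous_intros continuous_on_ray[OF assms])

lemma ray_avg_diff:
  assumes "star_at_0 U" "continuous_on U f" "continuous_on U g" "u \<in> U"
  shows "ray_avg p f u - ray_avg p g u = ray_avg p (\<lambda>v. f v - g v) u"
proof -
  have "((\<lambda>s. s ^ p *\<^sub>R f (s *\<^sub>R u) - s ^ p *\<^sub>R g (s *\<^sub>R u)) has_integral
        (ray_avg p f u - ray_avg p g u)) {0..1}"
    by (intro has_integral_diff has_integral_ray_avg[OF assms(1)] assms)
  then show ?thesis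
    by (simp add: ray_avg_def integral_unique scaleR_diff_right)
qed

text \<open>The weight is only estimated by \<open>s ^ p \<le> 1\<close>; the gain 1/(p+1) is given
  away in exchange for contraction constants that are the same for all \<open>p\<close>.\<close>

lemma norm_ray_avg_le:
  assumes "star_at_0 U" "continuous_on U f" "u \<in> U" "\<And>v. v \<in> U \<Longrightarrow> norm (f v) \<le> M"
  shows "norm (ray_avg p f u) \<le> M"
proof -
  have "0 \<le> M" using assms(3,4) norm_ge_zero order_trans by blast
  moreover have "norm (s ^ p *\<^sub>R f (s *\<^sub>R u)) \<le> M" if "s \<in> {0..1}" for s
  proof -
    have "norm (f (s *\<^sub>R u)) \<le> M" using assms that by (auto simp: star_at_0_def)
    moreover have "s ^ p \<le> 1" "0 \<le> s ^ p" using that by (auto intro: power_le_one)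
    ultimately show ?thesis
      using mult_mono[of "s ^ p" 1 "norm (f (s *\<^sub>R u))" M] that by simp
  qed
  ultimately show ?thesis
    using has_integral_bound[of M _ _ 0 1, OF _ has_integral_ray_avg[OF assms(1-3), unfolded cbox_interval[symmetric]]]
    by auto
qed

lemma continuous_on_ray_avg:
  assumes "star_at_0 U" "continuous_on U f"
  shows "continuous_on U (ray_avg p f)"
proof -
  have "continuous_on (U \<times> cbox 0 1) (\<lambda>(u, s). s ^ p *\<^sub>R f (s *\<^sub>R u))"
    unfolding split_beta
    by (intro continuous_intros continuous_on_compose2[OF assms(2)])
       (use assms(1) in \<open>auto simp: star_at_0_def\<close>)
  from integral_continuous_on_param[OF this] show ?thesis
    by (simp add: ray_avg_def[abs_def])
qed

text \<open>Differentiability along lines only, as in the partial derivatives of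
  \<open>is_Cm\<close>. The derivative is an explicit function, so that it can in turn be a solution
  or a coefficient of an equation.\<close>

definition has_dir_deriv :: "'a::real_normed_vector \<Rightarrow> ('a \<Rightarrow> 'b::real_normed_vector) \<Rightarrow> ('a \<Rightarrow> 'b) \<Rightarrow> 'a set \<Rightarrow> bool" where
  "has_dir_deriv e f D U \<longleftrightarrow> (\<forall>u\<in>U. ((\<lambda>t. f (u + t *\<^sub>R e)) has_vector_derivative D u) (at 0))"

text \<open>Moving the base point along the line turns derivatives at parameter 0 into derivatives
  at every parameter, the form in which differentiation under the integral and termwise
  differentiation are used below.\<close>

lemma has_dir_deriv_shift:
  assumes "has_dir_deriv e f D U" "u + t *\<^sub>R e \<in> U"
  shows "((\<lambda>t. f (u + t *\<^sub>R e)) has_vector_derivative D (u + t *\<^sub>R e)) (at t)"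
proof -
  have "((\<lambda>s. f ((u + t *\<^sub>R e) + s *\<^sub>R e)) has_vector_derivative D (u + t *\<^sub>R e)) (at (t - t))"
    using assms by (simp add: has_dir_deriv_def)
  moreover have "((\<lambda>s. s - t) has_vector_derivative 1) (at t)"
    by (auto intro!: derivative_eq_intros)
  ultimately show ?thesis
    using vector_diff_chain_at[of "\<lambda>s. s - t" 1 t "\<lambda>s. f ((u + t *\<^sub>R e) + s *\<^sub>R e)" "D (u + t *\<^sub>R e)"]
    by (simp add: o_def algebra_simps)
qed

lemma open_line_nbhd:
  fixes U :: "'a::real_normed_vector set"
  assumes "open U" "u \<in> U"
  obtains \<delta> :: real where "\<delta> > 0" "\<And>t. \<bar>t\<bar> < \<delta> \<Longrightarrow> u + t *\<^sub>R e \<in> U"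
proof -
  have "open ((\<lambda>t. u + t *\<^sub>R e) -` U)"
    by (intro open_vimage assms continuous_intros)
  then obtain \<delta> where "\<delta> > 0" "ball 0 \<delta> \<subseteq> (\<lambda>t. u + t *\<^sub>R e) -` U"
    using assms(2) by (force simp: open_contains_ball)
  then show ?thesis by (intro that[of \<delta>]) auto
qed

text \<open>Differentiation under the integral sign. Moving \<open>u\<close> by \<open>t e\<close>
  moves the point \<open>s u\<close> by \<open>s t e\<close>, and this inner factor \<open>s\<close>
  raises the weight from \<open>p\<close> to \<open>Suc p\<close>.\<close>

lemma has_dir_deriv_ray_avg:
  assumes "open U" "star_at_0 U" "continuous_on U f" "continuous_on U D" "has_dir_deriv e f D U"
  shows "has_dir_deriv e (ray_avg p f) (ray_avg (Suc p) D) U"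
  unfolding has_dir_deriv_def
proof
  fix u assume "u \<in> U"
  then obtain \<delta> where \<delta>: "\<delta> > 0" "\<And>t. \<bar>t\<bar> < \<delta> \<Longrightarrow> u + t *\<^sub>R e \<in> U"
    using open_line_nbhd[OF assms(1)] by metis
  have at0: "at 0 within {-\<delta><..<\<delta>} = at 0" using \<delta>(1) by (intro at_within_open) auto
  have inU: "s *\<^sub>R (u + t *\<^sub>R e) \<in> U" if "t \<in> {-\<delta><..<\<delta>}" "s \<in> {0..1}" for s t
    using \<delta>(2)[of t] that assms(2) by (auto simp: star_at_0_def)
  have "((\<lambda>t. integral (cbox 0 1) (\<lambda>s. s ^ p *\<^sub>R f (s *\<^sub>R (u + t *\<^sub>R e)))) has_vector_derivative
        integral (cbox 0 1) (\<lambda>s. s ^ Suc p *\<^sub>R D (s *\<^sub>R (u + 0 *\<^sub>R e)))) (at 0 within {-\<delta><..<\<delta>})"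
  proof (rule leibniz_rule_vector_derivative)
    fix t s :: real assume t: "t \<in> {-\<delta><..<\<delta>}" and s: "s \<in> cbox 0 1"
    have "s *\<^sub>R u + (s * t) *\<^sub>R e \<in> U" using inU[OF t] s by (simp add: algebra_simps)
    from has_dir_deriv_shift[OF assms(5) this]
    have *: "((\<lambda>t. f (s *\<^sub>R u + t *\<^sub>R e)) has_vector_derivative D (s *\<^sub>R u + (s * t) *\<^sub>R e)) (at (s * t))" .
    have "((\<lambda>t. s * t) has_vector_derivative s) (at t)"
      by (auto intro!: derivative_eq_intros)
    from vector_diff_chain_at[OF this *]
    have "((\<lambda>t. f (s *\<^sub>R (u + t *\<^sub>R e))) has_vector_derivative s *\<^sub>R D (s *\<^sub>R (u + t *\<^sub>R e))) (at t)"
      by (simp add: o_def algebra_simps)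
    from bounded_linear.has_vector_derivative[OF bounded_linear_scaleR_right this, of "s ^ p"]
    show "((\<lambda>t. s ^ p *\<^sub>R f (s *\<^sub>R (u + t *\<^sub>R e))) has_vector_derivative s ^ Suc p *\<^sub>R D (s *\<^sub>R (u + t *\<^sub>R e)))
          (at t within {-\<delta><..<\<delta>})"
      by (auto intro: has_vector_derivative_at_within simp: mult.commute)
  next
    fix t assume "t \<in> {-\<delta><..<\<delta>}"
    then have "u + t *\<^sub>R e \<in> U" using \<delta>(2)[of t] by auto
    from has_integral_ray_avg[OF assms(2,3) this]
    show "(\<lambda>s. s ^ p *\<^sub>R f (s *\<^sub>R (u + t *\<^sub>R e))) integrable_on cbox 0 1" by auto
  next
    show "continuous_on ({-\<delta><..<\<delta>} \<times> cbox 0 1) (\<lambda>(t, s). s ^ Suc p *\<^sub>R D (s *\<^sub>R (u + t *\<^sub>R e)))"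
      unfolding split_beta
      by (intro continuous_intros continuous_on_compose2[OF assms(4)]) (use inU in auto)
  qed (use \<delta> in auto)
  then have "((\<lambda>t. ray_avg p f (u + t *\<^sub>R e)) has_vector_derivative ray_avg (Suc p) D u) (at 0 within {-\<delta><..<\<delta>})"
    by (simp add: ray_avg_def)
  then show "((\<lambda>t. ray_avg p f (u + t *\<^sub>R e)) has_vector_derivative ray_avg (Suc p) D u) (at 0)"
    by (simp only: at0)
qed

text \<open>Termwise differentiation on a short segment through \<open>u\<close>; the limit function
  that the library theorem produces is then identified with \<open>g\<close> by uniqueness of
  limits.\<close>

lemma has_dir_deriv_uniform_limit:
  fixes f :: "nat \<Rightarrow> 'a::real_normed_vector \<Rightarrow> 'b::banach"
  assumes U: "open U" and D: "\<And>n. has_dir_deriv e (f n) (D n) U"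
    and lim: "\<And>u. u \<in> U \<Longrightarrow> (\<lambda>n. f n u) \<longlonglongrightarrow> g u" and ul: "uniform_limit U D G sequentially"
  shows "has_dir_deriv e g G U"
  unfolding has_dir_deriv_def
proof
  fix u assume u: "u \<in> U"
  then obtain \<delta> where \<delta>: "\<delta> > 0" "\<And>t. \<bar>t\<bar> < \<delta> \<Longrightarrow> u + t *\<^sub>R e \<in> U"
    using open_line_nbhd[OF U] by metis
  let ?S = "{-\<delta><..<\<delta>}"
  have at0: "at 0 within ?S = at 0" using \<delta>(1) by (intro at_within_open) auto
  have "\<exists>h. \<forall>t\<in>?S. (\<lambda>n. f n (u + t *\<^sub>R e)) \<longlonglongrightarrow> h t \<and>
          (h has_derivative (\<lambda>x. x *\<^sub>R G (u + t *\<^sub>R e))) (at t within ?S)"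
  proof (rule has_derivative_sequence[where f' = "\<lambda>n t x. x *\<^sub>R D n (u + t *\<^sub>R e)"])
    show "((\<lambda>t. f n (u + t *\<^sub>R e)) has_derivative (\<lambda>x. x *\<^sub>R D n (u + t *\<^sub>R e))) (at t within ?S)"
      if "t \<in> ?S" for n t
      using has_dir_deriv_shift[OF D, of u t n] \<delta>(2)[of t] that
      by (auto simp: has_vector_derivative_def intro: has_derivative_at_withinI)
    show "\<forall>\<^sub>F n in sequentially. \<forall>t\<in>?S. \<forall>h. norm (h *\<^sub>R D n (u + t *\<^sub>R e) - h *\<^sub>R G (u + t *\<^sub>R e)) \<le> \<epsilon> * norm h"
      if "\<epsilon> > 0" for \<epsilon>
      using uniform_limitD[OF ul that]
    proof eventually_elim
      case (elim n)
      show ?case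
      proof (intro ballI allI)
        fix t h :: real assume "t \<in> ?S"
        then have "dist (D n (u + t *\<^sub>R e)) (G (u + t *\<^sub>R e)) < \<epsilon>" using elim \<delta>(2)[of t] by auto
        then have "norm h * norm (D n (u + t *\<^sub>R e) - G (u + t *\<^sub>R e)) \<le> norm h * \<epsilon>"
          by (intro mult_left_mono) (auto simp: dist_norm)
        then show "norm (h *\<^sub>R D n (u + t *\<^sub>R e) - h *\<^sub>R G (u + t *\<^sub>R e)) \<le> \<epsilon> * norm h"
          by (simp add: scaleR_diff_right[symmetric] mult.commute)
      qed
    qed
    show "(\<lambda>n. f n (u + 0 *\<^sub>R e)) \<longlonglongrightarrow> g u" using lim[OF u] by simp
  qed (use \<delta> in auto)
  then obtain h where h: "\<And>t. t \<in> ?S \<Longrightarrow> (\<lambda>n. f n (u + t *\<^sub>R e)) \<longlonglongrightarrow> h t"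
    "\<And>t. t \<in> ?S \<Longrightarrow> (h has_vector_derivative G (u + t *\<^sub>R e)) (at t within ?S)"
    unfolding has_vector_derivative_def by blast
  have "h t = g (u + t *\<^sub>R e)" if "t \<in> ?S" for t
    using LIMSEQ_unique[OF h(1)[OF that] lim] \<delta>(2)[of t] that by auto
  then have "((\<lambda>t. g (u + t *\<^sub>R e)) has_vector_derivative G (u + 0 *\<^sub>R e)) (at 0 within ?S)"
    by (intro has_vector_derivative_transform[OF _ _ h(2)]) (use \<delta>(1) in auto)
  then show "((\<lambda>t. g (u + t *\<^sub>R e)) has_vector_derivative G u) (at 0)"
    by (simp only: at0 scaleR_zero_left add_0_right)
qed

lemma has_dir_deriv_add:
  assumes "has_dir_deriv e f D U" "has_dir_deriv e g E U"
  shows "has_dir_deriv e (\<lambda>u. f u + g u) (\<lambda>u. D u + E u) U"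
  using assms unfolding has_dir_deriv_def by (auto intro: has_vector_derivative_add)

lemma has_dir_deriv_linear:
  assumes "bounded_linear T" "has_dir_deriv e f D U"
  shows "has_dir_deriv e (\<lambda>u. T (f u)) (\<lambda>u. T (D u)) U"
  using assms unfolding has_dir_deriv_def by (auto intro: bounded_linear.has_vector_derivative)

lemma has_dir_deriv_bilinear:
  assumes "bounded_bilinear b" "has_dir_deriv e f D U" "has_dir_deriv e g E U"
  shows "has_dir_deriv e (\<lambda>u. b (f u) (g u)) (\<lambda>u. b (f u) (E u) + b (D u) (g u)) U"
  unfolding has_dir_deriv_def
proof
  fix u assume "u \<in> U"
  then have "((\<lambda>t. f (u + t *\<^sub>R e)) has_vector_derivative D u) (at 0)" "((\<lambda>t. g (u + t *\<^sub>R e)) has_vector_derivative E u) (at 0)"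
    using assms(2,3) by (auto simp: has_dir_deriv_def)
  from bounded_bilinear.has_vector_derivative[OF assms(1) this]
  show "((\<lambda>t. b (f (u + t *\<^sub>R e)) (g (u + t *\<^sub>R e))) has_vector_derivative b (f u) (E u) + b (D u) (g u)) (at 0)"
    by simp
qed

lemma has_dir_deriv_cong:
  assumes "open U" "has_dir_deriv e f D U" "\<And>u. u \<in> U \<Longrightarrow> f u = g u" "\<And>u. u \<in> U \<Longrightarrow> D u = E u"
  shows "has_dir_deriv e g E U"
  unfolding has_dir_deriv_def
proof
  fix u assume u: "u \<in> U"
  then obtain \<delta> where \<delta>: "\<delta> > 0" "\<And>t. \<bar>t\<bar> < \<delta> \<Longrightarrow> u + t *\<^sub>R e \<in> U"
    using open_line_nbhd[OF assms(1)] by metis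
  have "((\<lambda>t. f (u + t *\<^sub>R e)) has_vector_derivative E u) (at 0)"
    using assms u by (auto simp: has_dir_deriv_def)
  then show "((\<lambda>t. g (u + t *\<^sub>R e)) has_vector_derivative E u) (at 0)"
    by (rule has_vector_derivative_transform_within[OF _ \<delta>(1)])
       (use \<delta>(2) assms(3) in \<open>auto simp: dist_real_def\<close>)
qed

section \<open>Quadratic equations along rays\<close>

lemma geometric_uniform_limit:
  fixes F :: "nat \<Rightarrow> 'a \<Rightarrow> 'b::banach"
  assumes "\<And>n u. u \<in> U \<Longrightarrow> norm (F (Suc n) u - F n u) \<le> M * q ^ n" "0 \<le> q" "q < 1"
  obtains G where "uniform_limit U F G sequentially"
proof -
  have "uniform_limit U (\<lambda>n u. \<Sum>i<n. F (Suc i) u - F i u) (\<lambda>u. \<Sum>i. F (Suc i) u - F i u) sequentially"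
    using assms by (intro Weierstrass_m_test[of _ _ "\<lambda>n. M * q ^ n"] summable_mult summable_geometric) auto
  then have "uniform_limit U (\<lambda>n u. F n u - F 0 u) (\<lambda>u. \<Sum>i. F (Suc i) u - F i u) sequentially"
    by (simp add: sum_lessThan_telescope[of "\<lambda>i. F i u" for u])
  from uniform_limit_add[OF this uniform_limit_const[of "F 0" U]]
  show thesis by (intro that[of "\<lambda>u. (\<Sum>i. F (Suc i) u - F i u) + F 0 u"]) simp
qed

lemma uniform_limit_geometric_bound:
  fixes F :: "nat \<Rightarrow> 'a \<Rightarrow> 'b::real_normed_vector"
  assumes "\<And>n u. u \<in> U \<Longrightarrow> norm (F n u - G u) \<le> M * q ^ n" "0 \<le> q" "q < 1"
  shows "uniform_limit U F G sequentially"
proof (rule uniform_limitI)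
  fix \<epsilon> :: real assume "\<epsilon> > 0"
  have "(\<lambda>n. M * q ^ n) \<longlonglongrightarrow> M * 0"
    using assms by (intro tendsto_mult tendsto_const LIMSEQ_realpow_zero) auto
  then have "\<forall>\<^sub>F n in sequentially. M * q ^ n < \<epsilon>"
    using \<open>\<epsilon> > 0\<close> by (intro order_tendstoD(2)[of _ "M * 0"]) auto
  then show "\<forall>\<^sub>F n in sequentially. \<forall>u\<in>U. dist (F n u) (G u) < \<epsilon>"
    by eventually_elim (use assms(1) in \<open>auto simp: dist_norm intro: le_less_trans\<close>)
qed

text \<open>A class of equations closed under differentiation: linear ones are included as
  \<open>b = 0\<close>, \<open>K = 0\<close>. Signs are absorbed into \<open>b\<close>,
  \<open>L\<close> and \<open>H\<close>. The coefficient \<open>L u\<close> is an element of the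
  normed space of operators so that it can itself be differentiated. No size of \<open>H\<close> is
  fixed here, because different bounds on it are used for existence, for decay and for
  regularity.\<close>

locale ray_eq =
  fixes U :: "'a::real_normed_vector set" and b :: "'v::banach \<Rightarrow> 'v \<Rightarrow> 'v" and K :: real
    and L :: "'a \<Rightarrow> 'v \<Rightarrow>\<^sub>L 'v" and l :: real and H :: "'a \<Rightarrow> 'v"
  assumes open_U: "open U" and star_U: "star_at_0 U" and nonempty_U: "U \<noteq> {}"
    and bilinear_b: "bounded_bilinear b" and K_nonneg: "0 \<le> K"
    and norm_b: "\<And>x y. norm (b x y) \<le> K * norm x * norm y"
    and cont_L: "continuous_on U L" and norm_L: "\<And>u. u \<in> U \<Longrightarrow> norm (L u) \<le> l"
    and cont_H: "continuous_on U H"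
begin

definition rhs :: "('a \<Rightarrow> 'v) \<Rightarrow> 'a \<Rightarrow> 'v" where
  "rhs A u = b (A u) (A u) + blinfun_apply (L u) (A u) + H u"

definition solves :: "nat \<Rightarrow> ('a \<Rightarrow> 'v) \<Rightarrow> bool" where
  "solves p A \<longleftrightarrow> continuous_on U A \<and> (\<forall>u\<in>U. A u = ray_avg p (rhs A) u)"

lemma l_nonneg: "0 \<le> l"
  using norm_L nonempty_U norm_ge_zero order_trans by blast

lemma norm_L_apply: "u \<in> U \<Longrightarrow> norm (blinfun_apply (L u) x) \<le> l * norm x"
  using norm_blinfun[of "L u" x] mult_right_mono[OF norm_L, of u "norm x"] by auto

lemma norm_b_le: "norm x \<le> c \<Longrightarrow> norm y \<le> d \<Longrightarrow> norm (b x y) \<le> K * (c * d)"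
proof -
  assume "norm x \<le> c" "norm y \<le> d"
  then have "norm x * norm y \<le> c * d" by (intro mult_mono) (auto intro: order_trans[OF norm_ge_zero])
  from mult_left_mono[OF this K_nonneg] show ?thesis using norm_b[of x y] by (simp add: mult.assoc)
qed

lemma continuous_on_rhs: "continuous_on U A \<Longrightarrow> continuous_on U (rhs A)"
  unfolding rhs_def[abs_def]
  by (intro continuous_intros bounded_bilinear.continuous_on[OF bilinear_b] cont_L cont_H)

lemma rhs_diff_le:
  assumes "u \<in> U" "norm (A u) \<le> c" "norm (B u) \<le> d" "norm (A u - B u) \<le> \<epsilon>"
  shows "norm (rhs A u - rhs B u) \<le> (K * (c + d) + l) * \<epsilon>"
proof -
  interpret bounded_bilinear b by (rule bilinear_b)
  \<comment> \<open>The difference of the two quadratic terms is telescoped through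
    \<open>b (B u) (A u)\<close>.\<close>
  have "rhs A u - rhs B u = b (A u - B u) (A u) + b (B u) (A u - B u) + blinfun_apply (L u) (A u - B u)"
    by (simp add: rhs_def diff_left diff_right blinfun.diff_right)
  also have "norm \<dots> \<le> K * (\<epsilon> * c) + K * (d * \<epsilon>) + l * \<epsilon>"
    using assms
    by (intro norm_triangle_mono norm_b_le order_trans[OF norm_L_apply] mult_left_mono l_nonneg)
  finally show ?thesis by (simp add: algebra_simps)
qed

lemma norm_rhs_le:
  assumes "u \<in> U" "norm (A u) \<le> c" "norm (H u) \<le> h"
  shows "norm (rhs A u) \<le> (K * c + l) * c + h"
proof -
  have "norm (rhs A u) \<le> K * (c * c) + l * c + h"
    unfolding rhs_def using assms
    by (intro norm_triangle_mono norm_b_le order_trans[OF norm_L_apply] mult_left_mono l_nonneg)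
  then show ?thesis by (simp add: algebra_simps)
qed

primrec picard :: "nat \<Rightarrow> nat \<Rightarrow> 'a \<Rightarrow> 'v" where
  "picard p 0 = (\<lambda>u. 0)"
| "picard p (Suc n) = ray_avg p (rhs (picard p n))"

lemma continuous_on_picard: "continuous_on U (picard p n)"
  by (induction n) (auto intro!: continuous_on_ray_avg[OF star_U] continuous_on_rhs)

text \<open>Banach's fixed point argument on functions bounded by \<open>a\<close>: the condition
  \<open>(K * a + l) * a + h \<le> a\<close> makes this set invariant, and
  \<open>2 * K * a + l \<le> q\<close> is the Lipschitz constant of the right-hand side on
  it.\<close>

lemma solves_exists:
  assumes q: "2 * K * a + l \<le> q" "q < 1" and a: "(K * a + l) * a + h \<le> a" "0 \<le> a"
    and h: "\<And>u. u \<in> U \<Longrightarrow> norm (H u) \<le> h"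
  obtains A where "solves p A" "\<And>u. u \<in> U \<Longrightarrow> norm (A u) \<le> a"
proof -
  have q0: "0 \<le> q" using q(1) mult_nonneg_nonneg[OF K_nonneg a(2)] l_nonneg by auto
  have bound: "norm (picard p n u) \<le> a" if "u \<in> U" for n u
    using that
  proof (induction n arbitrary: u)
    case (Suc n)
    have "norm (rhs (picard p n) v) \<le> a" if "v \<in> U" for v
      using norm_rhs_le[of v "picard p n" a h, OF that Suc.IH[OF that] h[OF that]] a(1) by simp
    then show ?case
      using norm_ray_avg_le[OF star_U continuous_on_rhs[OF continuous_on_picard] Suc.prems] by simp
  qed (use a in auto)
  have contract: "norm (ray_avg p (rhs A) u - ray_avg p (rhs B) u) \<le> q * \<epsilon>"
    if "continuous_on U A" "continuous_on U B" "u \<in> U" "\<And>v. v \<in> U \<Longrightarrow> norm (A v) \<le> a"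
      "\<And>v. v \<in> U \<Longrightarrow> norm (B v) \<le> a" "\<And>v. v \<in> U \<Longrightarrow> norm (A v - B v) \<le> \<epsilon>" for A B u \<epsilon>
  proof -
    have "0 \<le> \<epsilon>" using that(3,6) norm_ge_zero order_trans by blast
    have "norm (rhs A v - rhs B v) \<le> q * \<epsilon>" if "v \<in> U" for v
      using rhs_diff_le[of v A a B a \<epsilon>, OF that \<open>\<And>v. v \<in> U \<Longrightarrow> norm (A v) \<le> a\<close> \<open>\<And>v. v \<in> U \<Longrightarrow> norm (B v) \<le> a\<close>
          \<open>\<And>v. v \<in> U \<Longrightarrow> norm (A v - B v) \<le> \<epsilon>\<close>, OF that that that]
        mult_right_mono[OF q(1) \<open>0 \<le> \<epsilon>\<close>] by (simp add: algebra_simps)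
    then show ?thesis
      unfolding ray_avg_diff[OF star_U continuous_on_rhs[OF that(1)] continuous_on_rhs[OF that(2)] that(3)]
      by (intro norm_ray_avg_le[OF star_U] continuous_intros continuous_on_rhs that)
  qed
  have "norm (picard p (Suc n) u - picard p n u) \<le> a * q ^ n" if "u \<in> U" for n u
    using that
  proof (induction n arbitrary: u)
    case 0
    then show ?case using bound[of u 1] by simp
  next
    case (Suc n)
    show ?case
      using contract[OF continuous_on_picard continuous_on_picard Suc.prems bound bound Suc.IH]
      by (simp add: mult_ac)
  qed
  then obtain A where A: "uniform_limit U (picard p) A sequentially"
    using geometric_uniform_limit q0 q(2) by metis
  have contA: "continuous_on U A"
    by (rule uniform_limit_theorem[OF _ A]) (simp_all add: continuous_on_picard)
  have lim: "(\<lambda>n. picard p n u) \<longlonglongrightarrow> A u" if "u \<in> U" for u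
    using tendsto_uniform_limitI[OF A that] .
  have Ale: "norm (A u) \<le> a" if "u \<in> U" for u
    by (rule LIMSEQ_le_const2[OF tendsto_norm[OF lim[OF that]]]) (use bound that in auto)
  have "A u = ray_avg p (rhs A) u" if u: "u \<in> U" for u
  proof (rule LIMSEQ_unique)
    show "(\<lambda>n. picard p (Suc n) u) \<longlonglongrightarrow> A u" using LIMSEQ_Suc[OF lim[OF u]] .
    show "(\<lambda>n. picard p (Suc n) u) \<longlonglongrightarrow> ray_avg p (rhs A) u"
    proof (rule tendstoI)
      fix \<epsilon> :: real assume \<epsilon>: "\<epsilon> > 0"
      show "\<forall>\<^sub>F n in sequentially. dist (picard p (Suc n) u) (ray_avg p (rhs A) u) < \<epsilon>"
        using uniform_limitD[OF A \<epsilon>]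
      proof eventually_elim
        case (elim n)
        have "norm (ray_avg p (rhs (picard p n)) u - ray_avg p (rhs A) u) \<le> q * \<epsilon>"
          using elim by (intro contract continuous_on_picard contA u bound Ale) (auto simp: dist_norm intro: less_imp_le)
        also have "\<dots> < \<epsilon>" using q(2) \<epsilon> by simp
        finally show ?case by (simp add: dist_norm)
      qed
    qed
  qed
  then show thesis using that contA Ale unfolding solves_def by blast
qed

text \<open>The bound improves itself: a bound \<open>s\<close> on \<open>A\<close> yields the bound \<open>q * s + h\<close>, so the
  supremum is at most \<open>h / (1 - q)\<close>.\<close>

lemma solves_bound:
  assumes sol: "solves p A" and a: "\<And>u. u \<in> U \<Longrightarrow> norm (A u) \<le> a" and q: "K * a + l \<le> q" "q < 1"
    and V: "star_at_0 V" "V \<subseteq> U" "u \<in> V" and h: "\<And>u. u \<in> V \<Longrightarrow> norm (H u) \<le> h"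
  shows "norm (A u) \<le> h / (1 - q)"
proof -
  define s where "s = (SUP v\<in>V. norm (A v))"
  have bdd: "bdd_above ((\<lambda>v. norm (A v)) ` V)" using a V(2) by (intro bdd_aboveI[of _ a]) auto
  have le_s: "norm (A v) \<le> s" if "v \<in> V" for v
    unfolding s_def by (rule cSUP_upper[OF that bdd])
  have s0: "0 \<le> s" using le_s[OF V(3)] norm_ge_zero order_trans by blast
  have s_le: "s \<le> a" unfolding s_def using V a by (intro cSUP_least) auto
  have "norm (rhs A v) \<le> q * s + h" if "v \<in> V" for v
  proof -
    have "norm (rhs A v) \<le> (K * s + l) * s + h"
      using that V le_s h by (intro norm_rhs_le) auto
    also have "(K * s + l) * s \<le> q * s" using mult_left_mono[OF s_le K_nonneg] q by (intro mult_right_mono s0) simp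
    finally show ?thesis by simp
  qed
  then have "norm (A v) \<le> q * s + h" if "v \<in> V" for v
    using norm_ray_avg_le[OF V(1) continuous_on_subset[OF continuous_on_rhs V(2)] that] sol V(2) that
    by (auto simp: solves_def)
  then have "s \<le> q * s + h" unfolding s_def using V(3) by (intro cSUP_least) auto
  then have "s * (1 - q) \<le> h" by (simp add: algebra_simps)
  then have "s \<le> h / (1 - q)" using q by (simp add: pos_le_divide_eq)
  then show ?thesis using le_s[OF V(3)] by simp
qed

text \<open>The derivative at \<open>x\<close> of the quadratic map given by \<open>b x x\<close>,
  packaged as an operator so that it can serve as a coefficient \<open>L\<close>.\<close>

definition bsym :: "'v \<Rightarrow> 'v \<Rightarrow>\<^sub>L 'v" where
  "bsym x = bounded_bilinear.prod_right b x + bounded_bilinear.prod_left b x"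

lemma bsym_apply: "blinfun_apply (bsym x) y = b x y + b y x"
  by (simp add: bsym_def bounded_bilinear.prod_right.rep_eq[OF bilinear_b]
      bounded_bilinear.prod_left.rep_eq[OF bilinear_b] blinfun.add_left)

lemma bounded_linear_bsym: "bounded_linear bsym"
  unfolding bsym_def[abs_def]
  by (intro bounded_linear_add bounded_bilinear.bounded_linear_prod_right bounded_bilinear.bounded_linear_prod_left bilinear_b)

lemma norm_bsym: "norm (bsym x) \<le> 2 * K * norm x"
proof (rule norm_blinfun_bound)
  show "0 \<le> 2 * K * norm x" using K_nonneg by simp
  fix y show "norm (blinfun_apply (bsym x) y) \<le> 2 * K * norm x * norm y"
    using norm_triangle_mono[OF norm_b[of x y] norm_b[of y x]] by (simp add: bsym_apply mult_ac)
qed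

text \<open>This is the equation that a partial derivative of \<open>A\<close> has to satisfy. Its
  quadratic part is zero, and the coefficient bound grows from \<open>l\<close> to
  \<open>2 * K * a + l\<close>, which is the contraction constant of the original equation.\<close>

lemma linearised_ray_eq:
  assumes "continuous_on U A" "\<And>u. u \<in> U \<Longrightarrow> norm (A u) \<le> a"
    and "continuous_on U DL" "continuous_on U DH"
  shows "ray_eq U (\<lambda>x y. 0) 0 (\<lambda>u. bsym (A u) + L u) (2 * K * a + l) (\<lambda>u. blinfun_apply (DL u) (A u) + DH u)"
proof (rule ray_eq.intro)
  show "norm (bsym (A u) + L u) \<le> 2 * K * a + l" if "u \<in> U" for u
    using assms(2)[OF that] K_nonneg
    by (intro norm_triangle_mono norm_L that order_trans[OF norm_bsym] mult_left_mono) auto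
  show "bounded_bilinear (\<lambda>x y::'v. 0::'v)" by unfold_locales (auto intro: exI[of _ 0])
qed (use open_U star_U nonempty_U cont_L assms in
    \<open>auto intro!: continuous_intros bounded_linear.continuous_on[OF bounded_linear_bsym]\<close>)

text \<open>The solution \<open>G\<close> of the linearised equation exists independently of any
  differentiability of \<open>A\<close>. The Picard iterates are differentiable, their derivatives
  satisfy a perturbed form of the equation for \<open>G\<close>, and uniform convergence to
  \<open>G\<close> makes \<open>G\<close> the derivative of \<open>A\<close>.\<close>

lemma solves_has_dir_deriv:
  assumes sol: "solves p A" and a: "\<And>u. u \<in> U \<Longrightarrow> norm (A u) \<le> a" and q: "4 * K * a + l \<le> q" "q < 1"
    and DL: "continuous_on U DL" "has_dir_deriv e L DL U" "\<And>u. u \<in> U \<Longrightarrow> norm (DL u) \<le> M"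
    and DH: "continuous_on U DH" "has_dir_deriv e H DH U" "\<And>u. u \<in> U \<Longrightarrow> norm (DH u) \<le> M"
  obtains G where "has_dir_deriv e A G U"
    "ray_eq.solves U (\<lambda>x y. 0) (\<lambda>u. bsym (A u) + L u) (\<lambda>u. blinfun_apply (DL u) (A u) + DH u) (Suc p) G"
    "\<And>u. u \<in> U \<Longrightarrow> norm (G u) \<le> (M * a + M) / (1 - q)"
proof -
  have contA: "continuous_on U A" and eqA: "\<And>u. u \<in> U \<Longrightarrow> A u = ray_avg p (rhs A) u"
    using sol by (auto simp: solves_def)
  have a0: "0 \<le> a" and M0: "0 \<le> M" using a DH(3) nonempty_U norm_ge_zero order_trans by blast+
  have q0: "0 \<le> q" using q(1) mult_nonneg_nonneg[OF K_nonneg a0] l_nonneg by auto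
  interpret lin: ray_eq U "\<lambda>x y. 0" 0 "\<lambda>u. bsym (A u) + L u" "2 * K * a + l" "\<lambda>u. blinfun_apply (DL u) (A u) + DH u"
    by (intro linearised_ray_eq contA a DL(1) DH(1))
  \<comment> \<open>The fixed point of \<open>g = q * g + (M * a + M)\<close>, hence the smallest
    radius for which the invariance condition with contraction \<open>q\<close> and source
    \<open>M * a + M\<close> holds.\<close>
  define g where "g = (M * a + M) / (1 - q)"
  have g0: "0 \<le> g" using M0 a0 q(2) by (simp add: g_def)
  have q': "2 * K * a + l \<le> q" using q(1) mult_nonneg_nonneg[OF K_nonneg a0] by simp
  have DLA: "norm (blinfun_apply (DL u) (A u)) \<le> M * a" if "u \<in> U" for u
    using norm_blinfun[of "DL u" "A u"] mult_mono[OF DL(3)[OF that] a[OF that]] M0 by simp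
  obtain G where G: "lin.solves (Suc p) G" "\<And>u. u \<in> U \<Longrightarrow> norm (G u) \<le> g"
  proof (rule lin.solves_exists[where a = g and q = q and h = "M * a + M" and p = "Suc p"])
    have "(2 * K * a + l) * g \<le> q * g" by (rule mult_right_mono[OF q' g0])
    moreover have "q * g + (M * a + M) = g" using q(2) by (simp add: g_def field_simps)
    ultimately show "(0 * g + (2 * K * a + l)) * g + (M * a + M) \<le> g" by simp
    show "norm (blinfun_apply (DL u) (A u) + DH u) \<le> M * a + M" if "u \<in> U" for u
      using that by (intro norm_triangle_mono DLA DH)
  qed (use q' q g0 in auto)
  have contG: "continuous_on U G" and eqG: "\<And>u. u \<in> U \<Longrightarrow> G u = ray_avg (Suc p) (lin.rhs G) u"
    using G(1) by (auto simp: lin.solves_def)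
  \<comment> \<open>The induction starts from the zero iterate, whose error is at most
    \<open>a\<close>. One step contracts by \<open>3 * K * a + l \<le> q\<close>, as the iterates
    are bounded by \<open>2 * a\<close> and \<open>A\<close> by \<open>a\<close>.\<close>
  have conv: "norm (picard p n u - A u) \<le> a * q ^ n" if "u \<in> U" for n u
    using that
  proof (induction n arbitrary: u)
    case (Suc n)
    have "norm (rhs (picard p n) v - rhs A v) \<le> q * (a * q ^ n)" if v: "v \<in> U" for v
    proof -
      have "a * q ^ n \<le> a" using a0 q0 q(2) by (simp add: mult_left_le power_le_one)
      then have "norm (picard p n v) \<le> 2 * a"
        using Suc.IH[OF v] a[OF v] norm_triangle_sub[of "picard p n v" "A v"] by simp
      from rhs_diff_le[of v "picard p n" "2 * a" A a, OF v this a[OF v] Suc.IH[OF v]]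
      have "norm (rhs (picard p n) v - rhs A v) \<le> (K * (2 * a + a) + l) * (a * q ^ n)" .
      also have "(K * (2 * a + a) + l) * (a * q ^ n) \<le> q * (a * q ^ n)"
        using a0 q0 q(1) mult_nonneg_nonneg[OF K_nonneg a0] by (intro mult_right_mono) (auto simp: algebra_simps)
      finally show ?thesis .
    qed
    then have "norm (ray_avg p (rhs (picard p n)) u - ray_avg p (rhs A) u) \<le> q * (a * q ^ n)"
      unfolding ray_avg_diff[OF star_U continuous_on_rhs[OF continuous_on_picard] continuous_on_rhs[OF contA] Suc.prems]
      by (intro norm_ray_avg_le[OF star_U] continuous_intros continuous_on_rhs continuous_on_picard contA Suc.prems)
    then show ?case using eqA[OF Suc.prems] by (simp add: mult_ac)
  qed (use a in auto)
  \<comment> \<open>The iterates are bounded through their distance from \<open>A\<close>, at the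
    cost of a factor 2. Linearising at such an iterate then costs \<open>2 * K * (2 * a)\<close>,
    which is the origin of \<open>4 * K * a\<close> in the smallness condition.\<close>
  have picard_le: "norm (picard p n u) \<le> 2 * a" if "u \<in> U" for n u
  proof -
    have "a * q ^ n \<le> a" using a0 q0 q(2) by (simp add: mult_left_le power_le_one)
    then show ?thesis
      using conv[OF that, of n] a[OF that] norm_triangle_sub[of "picard p n u" "A u"] by simp
  qed
  \<comment> \<open>The formal derivative of the right-hand side at the n-th iterate, with
    \<open>E\<close> in place of the derivative of that iterate.\<close>
  define R where "R = (\<lambda>n E u. blinfun_apply (bsym (picard p n u) + L u) (E u) + blinfun_apply (DL u) (picard p n u) + DH u)"
  define D where "D = rec_nat (\<lambda>u. 0) (\<lambda>n E. ray_avg (Suc p) (R n E))"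
  have D0: "D 0 = (\<lambda>u. 0)" and DSuc: "D (Suc n) = ray_avg (Suc p) (R n (D n))" for n
    by (simp_all add: D_def)
  have contR: "continuous_on U (R n E)" if "continuous_on U E" for n E
    unfolding R_def
    by (intro continuous_intros bounded_linear.continuous_on[OF bounded_linear_bsym] continuous_on_picard that cont_L DL DH)
  have contD: "continuous_on U (D n)" for n
    by (induction n) (auto simp: D0 DSuc intro!: continuous_on_ray_avg[OF star_U] contR)
  have deriv: "has_dir_deriv e (picard p n) (D n) U" for n
  proof (induction n)
    case 0
    then show ?case by (simp add: D0 has_dir_deriv_def)
  next
    case (Suc n)
    have "has_dir_deriv e (rhs (picard p n)) (\<lambda>u. b (picard p n u) (D n u) + b (D n u) (picard p n u)
      + (blinfun_apply (L u) (D n u) + blinfun_apply (DL u) (picard p n u)) + DH u) U"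
      unfolding rhs_def[abs_def]
      by (intro has_dir_deriv_add has_dir_deriv_bilinear[OF bilinear_b Suc Suc] DH(2)
          has_dir_deriv_bilinear[OF bounded_bilinear_blinfun_apply DL(2) Suc])
    then have "has_dir_deriv e (rhs (picard p n)) (R n (D n)) U"
      by (simp add: R_def blinfun.add_left bsym_apply add_ac)
    from has_dir_deriv_ray_avg[OF open_U star_U continuous_on_rhs[OF continuous_on_picard] contR[OF contD] this]
    show ?case by (simp add: DSuc)
  qed
  \<comment> \<open>The error of the derivatives contracts by \<open>q\<close> in each step but
    receives a new contribution of order \<open>q ^ n\<close>, so it behaves like
    \<open>n * q ^ n\<close>. Any rate strictly between \<open>q\<close> and 1 absorbs the factor
    \<open>n\<close>.\<close>
  define r where "r = (1 + q) / 2"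
  have r: "q < r" "r < 1" "0 \<le> r" using q(2) q0 by (auto simp: r_def)
  define W where "W = (2 * K * g + M) * a"
  have W0: "0 \<le> W" using K_nonneg g0 M0 a0 by (simp add: W_def)
  \<comment> \<open>The first entry covers the initial error, which is the size of \<open>G\<close>;
    the second is what the induction step \<open>q * Z + W \<le> Z * r\<close> asks for.\<close>
  define Z where "Z = max g (W / (r - q))"
  have "W / (r - q) \<le> Z" by (simp add: Z_def)
  then have ZW: "q * Z + W \<le> Z * r" using r by (simp add: pos_divide_le_eq algebra_simps)
  have convD: "norm (D n u - G u) \<le> Z * r ^ n" if "u \<in> U" for n u
    using that
  proof (induction n arbitrary: u)
    case 0
    then show ?case using G(2)[of u] by (simp add: D0 Z_def le_max_iff_disj)
  next
    case (Suc n)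
    have "norm (R n (D n) v - lin.rhs G v) \<le> Z * r ^ Suc n" if v: "v \<in> U" for v
    proof -
      let ?P = "picard p n v"
      have qr: "q ^ n \<le> r ^ n" using q0 r by (intro power_mono) auto
      have "R n (D n) v - lin.rhs G v = blinfun_apply (bsym ?P + L v) (D n v - G v)
          + blinfun_apply (bsym (?P - A v)) (G v) + blinfun_apply (DL v) (?P - A v)"
        by (simp add: R_def lin.rhs_def blinfun.diff_right blinfun.add_left
            linear_diff[OF bounded_linear.linear[OF bounded_linear_bsym]] blinfun.diff_left)
      also have "norm \<dots> \<le> q * (Z * r ^ n) + (2 * K * (a * q ^ n)) * g + M * (a * q ^ n)"
      proof (intro norm_triangle_mono order_trans[OF norm_blinfun] mult_mono conv[OF v] DL(3)[OF v] Suc.IH[OF v] G(2)[OF v])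
        have "norm (bsym ?P + L v) \<le> 2 * K * (2 * a) + l"
          using picard_le[OF v, of n] K_nonneg
          by (intro norm_triangle_mono norm_L v order_trans[OF norm_bsym] mult_left_mono) auto
        then show "norm (bsym ?P + L v) \<le> q" using q(1) by simp
        show "norm (bsym (?P - A v)) \<le> 2 * K * (a * q ^ n)"
          using conv[OF v, of n] K_nonneg by (intro order_trans[OF norm_bsym] mult_left_mono) auto
      qed (use q0 K_nonneg a0 M0 in auto)
      also have "\<dots> = q * Z * r ^ n + W * q ^ n" by (simp add: W_def algebra_simps)
      also have "\<dots> \<le> q * Z * r ^ n + W * r ^ n" using qr W0 by (intro add_left_mono mult_left_mono)
      also have "\<dots> = (q * Z + W) * r ^ n" by (simp add: algebra_simps)
      also have "\<dots> \<le> (Z * r) * r ^ n" using ZW r by (intro mult_right_mono) auto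
      finally show ?thesis by (simp add: mult_ac)
    qed
    then have "norm (ray_avg (Suc p) (R n (D n)) u - ray_avg (Suc p) (lin.rhs G) u) \<le> Z * r ^ Suc n"
      unfolding ray_avg_diff[OF star_U contR[OF contD] lin.continuous_on_rhs[OF contG] Suc.prems]
      by (intro norm_ray_avg_le[OF star_U] continuous_intros lin.continuous_on_rhs contR contD contG Suc.prems)
    then show ?case using eqG[OF Suc.prems] by (simp add: DSuc)
  qed
  have "has_dir_deriv e A G U"
  proof (rule has_dir_deriv_uniform_limit[OF open_U deriv])
    show "uniform_limit U D G sequentially"
      by (rule uniform_limit_geometric_bound[OF convD r(3,2)])
    show "(\<lambda>n. picard p n u) \<longlonglongrightarrow> A u" if "u \<in> U" for u
      by (rule tendsto_uniform_limitI[OF uniform_limit_geometric_bound[OF conv q0 q(2)] that])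
  qed
  then show thesis using that G by (simp add: g_def)
qed

end

section \<open>Regularity\<close>

text \<open>A vector-valued, recursive form of C^m regularity in which one \<open>M\<close> bounds
  each iterated partial derivative separately. The recursion differentiates the function first,
  which matches the way in which equations for derivatives are obtained.\<close>

fun Ck_bound :: "nat \<Rightarrow> real \<Rightarrow> (real^'k \<Rightarrow> 'b::real_normed_vector) \<Rightarrow> (real^'k) set \<Rightarrow> bool" where
  "Ck_bound 0 M f U \<longleftrightarrow> continuous_on U f \<and> (\<forall>u\<in>U. norm (f u) \<le> M)"
| "Ck_bound (Suc m) M f U \<longleftrightarrow> continuous_on U f \<and> (\<forall>u\<in>U. norm (f u) \<le> M) \<and>
     (\<forall>i. \<exists>D. has_dir_deriv (axis i 1) f D U \<and> Ck_bound m M D U)"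

lemma Ck_bound_0: "Ck_bound m M f U \<Longrightarrow> continuous_on U f \<and> (\<forall>u\<in>U. norm (f u) \<le> M)"
  by (cases m) auto

lemma Ck_bound_SucE:
  assumes "Ck_bound (Suc m) M f U"
  obtains D where "has_dir_deriv (axis i 1) f D U" "Ck_bound m M D U"
  using assms by (meson Ck_bound.simps(2))

lemma Ck_bound_SucI:
  assumes "continuous_on U f" "\<And>u. u \<in> U \<Longrightarrow> norm (f u) \<le> M"
    and "\<And>i. \<exists>D. has_dir_deriv (axis i 1) f D U \<and> Ck_bound m M D U"
  shows "Ck_bound (Suc m) M f U"
  using assms by simp

lemma Ck_bound_SucD: "Ck_bound (Suc m) M f U \<Longrightarrow> Ck_bound m M f U"
proof (induction m arbitrary: f)
  case (Suc m)
  then show ?case by (simp only: Ck_bound.simps(2)[of "Suc m"] Ck_bound.simps(2)[of m]) blast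
qed simp

lemma Ck_bound_mono: "Ck_bound m M f U \<Longrightarrow> M \<le> N \<Longrightarrow> Ck_bound m N f U"
proof (induction m arbitrary: f)
  case (Suc m)
  show ?case
  proof (rule Ck_bound_SucI)
    show "\<exists>D. has_dir_deriv (axis i 1) f D U \<and> Ck_bound m N D U" for i
      using Suc.IH[OF _ Suc.prems(2)] Ck_bound_SucE[OF Suc.prems(1)] by metis
  qed (use Suc.prems Ck_bound_0[OF Suc.prems(1)] in \<open>auto intro: order_trans\<close>)
qed (auto intro: order_trans)

lemma Ck_bound_const: "Ck_bound m (norm c) (\<lambda>u. c) U"
proof -
  have z: "Ck_bound m M (\<lambda>u. 0) U" if "0 \<le> M" for m and M :: real
    using that by (induction m) (auto simp: has_dir_deriv_def intro!: exI[of _ "\<lambda>u. 0"])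
  show ?thesis
    by (cases m) (auto simp: has_dir_deriv_def intro!: z exI[of _ "\<lambda>u. 0"])
qed

lemma Ck_bound_add:
  "Ck_bound m M f U \<Longrightarrow> Ck_bound m N g U \<Longrightarrow> Ck_bound m (M + N) (\<lambda>u. f u + g u) U"
proof (induction m arbitrary: f g)
  case (Suc m)
  have "\<exists>D. has_dir_deriv (axis i 1) (\<lambda>u. f u + g u) D U \<and> Ck_bound m (M + N) D U" for i
  proof -
    obtain D E where "has_dir_deriv (axis i 1) f D U" "Ck_bound m M D U"
      "has_dir_deriv (axis i 1) g E U" "Ck_bound m N E U"
      using Suc.prems by (meson Ck_bound.simps(2))
    then show ?thesis using Suc.IH has_dir_deriv_add by blast
  qed
  then show ?case using Suc.prems by (auto intro!: continuous_intros norm_triangle_mono)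
qed (auto intro!: continuous_intros norm_triangle_mono)

lemma Ck_bound_sum:
  assumes "finite I" "\<And>i. i \<in> I \<Longrightarrow> Ck_bound m (M i) (f i) U"
  shows "Ck_bound m (\<Sum>i\<in>I. M i) (\<lambda>u. \<Sum>i\<in>I. f i u) U"
  using assms
proof (induction I rule: finite_induct)
  case empty
  show ?case using Ck_bound_const[of m 0 U] by simp
qed (auto intro!: Ck_bound_add)

lemma Ck_bound_linear:
  assumes T: "bounded_linear T" "\<And>x. norm (T x) \<le> K * norm x" "0 \<le> K"
  shows "Ck_bound m M f U \<Longrightarrow> Ck_bound m (K * M) (\<lambda>u. T (f u)) U"
proof (induction m arbitrary: f)
  case 0
  then show ?case
    by (auto intro!: bounded_linear.continuous_on[OF T(1)] order_trans[OF T(2)] mult_left_mono T(3))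
next
  case (Suc m)
  have "\<exists>D. has_dir_deriv (axis i 1) (\<lambda>u. T (f u)) D U \<and> Ck_bound m (K * M) D U" for i
  proof -
    obtain D where "has_dir_deriv (axis i 1) f D U" "Ck_bound m M D U"
      using Suc.prems by (meson Ck_bound.simps(2))
    then show ?thesis using Suc.IH has_dir_deriv_linear[OF T(1)] by blast
  qed
  then show ?case using Suc.prems
    by (auto intro!: bounded_linear.continuous_on[OF T(1)] order_trans[OF T(2)] mult_left_mono T(3))
qed

text \<open>The product rule doubles the number of terms with each derivative, whence
  \<open>2 ^ m\<close>.\<close>

lemma Ck_bound_bilinear:
  assumes b: "bounded_bilinear b" "\<And>x y. norm (b x y) \<le> K * norm x * norm y" "0 \<le> K"
    and MN: "0 \<le> M" "0 \<le> N"
  shows "Ck_bound m M f U \<Longrightarrow> Ck_bound m N g U \<Longrightarrow> Ck_bound m (2 ^ m * (K * M * N)) (\<lambda>u. b (f u) (g u)) U"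
proof (induction m arbitrary: f g)
  have bd: "norm (b x y) \<le> K * M * N" if "norm x \<le> M" "norm y \<le> N" for x y
    using b(2)[of x y] mult_mono[OF mult_left_mono[OF that(1) b(3)] that(2)] b(3) MN by simp
  case 0
  then show ?case by (auto intro!: bounded_bilinear.continuous_on[OF b(1)] bd)
next
  case (Suc m)
  have "\<exists>D. has_dir_deriv (axis i 1) (\<lambda>u. b (f u) (g u)) D U \<and> Ck_bound m (2 ^ Suc m * (K * M * N)) D U" for i
  proof -
    obtain D E where DE: "has_dir_deriv (axis i 1) f D U" "Ck_bound m M D U"
      "has_dir_deriv (axis i 1) g E U" "Ck_bound m N E U"
      using Suc.prems by (meson Ck_bound.simps(2))
    have "Ck_bound m (2 ^ m * (K * M * N) + 2 ^ m * (K * M * N)) (\<lambda>u. b (f u) (E u) + b (D u) (g u)) U"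
      by (intro Ck_bound_add Suc.IH DE Suc.prems[THEN Ck_bound_SucD])
    moreover have "2 ^ m * (K * M * N) + 2 ^ m * (K * M * N) = 2 ^ Suc m * (K * M * N)" by simp
    ultimately show ?thesis using has_dir_deriv_bilinear[OF b(1) DE(1,3)] by metis
  qed
  moreover have "continuous_on U (\<lambda>u. b (f u) (g u))"
    and le: "\<forall>u\<in>U. norm (b (f u) (g u)) \<le> 2 ^ m * (K * M * N)"
    using Ck_bound_0[OF Suc.IH[OF Suc.prems[THEN Ck_bound_SucD]]] by auto
  moreover have "2 ^ m * (K * M * N) \<le> 2 ^ Suc m * (K * M * N)" using b(3) MN by simp
  then have "norm (b (f u) (g u)) \<le> 2 ^ Suc m * (K * M * N)" if "u \<in> U" for u
    using le that by (meson order_trans)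
  ultimately show ?case by (intro Ck_bound_SucI)
qed

lemma Ck_bound_cong:
  assumes "open U"
  shows "Ck_bound m M f U \<Longrightarrow> (\<And>u. u \<in> U \<Longrightarrow> f u = g u) \<Longrightarrow> Ck_bound m M g U"
proof (cases m)
  case (Suc n)
  assume f: "Ck_bound m M f U" and eq: "\<And>u. u \<in> U \<Longrightarrow> f u = g u"
  have "\<exists>D. has_dir_deriv (axis i 1) g D U \<and> Ck_bound n M D U" for i
  proof -
    obtain D where D: "has_dir_deriv (axis i 1) f D U" "Ck_bound n M D U"
      using f[unfolded Suc] by (rule Ck_bound_SucE)
    have "has_dir_deriv (axis i 1) g D U"
      by (rule has_dir_deriv_cong[OF assms D(1)]) (auto simp: eq)
    then show ?thesis using D(2) by blast
  qed
  then show ?thesis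
    using Ck_bound_0[OF f] eq unfolding Suc by (intro Ck_bound_SucI) (auto cong: continuous_on_cong)
qed (auto cong: continuous_on_cong)

lemma Ck_bound_component:
  fixes U :: "(real^'k) set"
  assumes "\<And>u. u \<in> U \<Longrightarrow> norm u \<le> R"
  shows "Ck_bound m (max R 1) (\<lambda>u. u $ j) U"
proof -
  have le: "norm (u $ j) \<le> max R 1" if "u \<in> U" for u
    using order_trans[OF component_le_norm_cart[of u j] assms[OF that]] by simp
  show ?thesis
  proof (cases m)
    case 0
    then show ?thesis using le by (auto intro!: continuous_intros)
  next
    case (Suc n)
    have "has_dir_deriv (axis i 1) (\<lambda>u::real^'k. u $ j) (\<lambda>u. axis i 1 $ j) U" for i
      unfolding has_dir_deriv_def by (auto intro!: derivative_eq_intros simp: has_real_derivative_iff_has_vector_derivative[symmetric])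
    moreover have "Ck_bound n (max R 1) (\<lambda>u::real^'k. axis i (1::real) $ j) U" for i
      by (rule Ck_bound_mono[OF Ck_bound_const]) (simp add: axis_def le_max_iff_disj)
    ultimately show ?thesis unfolding Suc using le
      by (intro Ck_bound_SucI continuous_intros) auto
  qed
qed

text \<open>The order of quantifiers is the point: \<open>N\<close> is found before the equation and
  its solution. The induction on \<open>m\<close> is applied twice. For \<open>A\<close> itself, one
  order lower, it gives the regularity of the coefficients of the linearised equation; for that
  equation, with weight \<open>Suc p\<close>, it gives the regularity of the partial derivatives of
  \<open>A\<close>.\<close>

lemma ray_eq_regularity:
  fixes U :: "(real^'k) set"
  assumes "q < 1"
  shows "\<exists>N. \<forall>(b :: 'v::banach \<Rightarrow> 'v \<Rightarrow> 'v) L l H A.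
    ray_eq U b K L l H \<longrightarrow> ray_eq.solves U b L H p A \<longrightarrow> (\<forall>u\<in>U. norm (A u) \<le> a) \<longrightarrow> 4 * K * a + l \<le> q \<longrightarrow>
    Ck_bound m M L U \<longrightarrow> Ck_bound m M H U \<longrightarrow> Ck_bound m N A U"
proof (induction m arbitrary: p K a M)
  case 0
  have "Ck_bound 0 (M / (1 - q)) A U"
    if "ray_eq U b K L l H" "ray_eq.solves U b L H p A" "\<forall>u\<in>U. norm (A u) \<le> a" "4 * K * a + l \<le> q" "Ck_bound 0 M H U"
    for b :: "'v \<Rightarrow> 'v \<Rightarrow> 'v" and L l H A
  proof -
    interpret ray_eq U b K L l H by fact
    have "0 \<le> a" using that(3) nonempty_U norm_ge_zero order_trans by blast
    then have "K * a + l \<le> q" using that(4) mult_nonneg_nonneg[OF K_nonneg, of a] by simp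
    then have "norm (A u) \<le> M / (1 - q)" if "u \<in> U" for u
      using \<open>solves p A\<close> \<open>\<forall>u\<in>U. norm (A u) \<le> a\<close> \<open>Ck_bound 0 M H U\<close> \<open>q < 1\<close> star_U that
      by (intro solves_bound[of p A a q U]) auto
    then show ?thesis using that(2) by (auto simp: solves_def)
  qed
  then show ?case by blast
next
  case (Suc m)
  obtain N where N: "\<And>(b :: 'v \<Rightarrow> 'v \<Rightarrow> 'v) L l H A.
    ray_eq U b K L l H \<Longrightarrow> ray_eq.solves U b L H p A \<Longrightarrow> \<forall>u\<in>U. norm (A u) \<le> a \<Longrightarrow> 4 * K * a + l \<le> q \<Longrightarrow>
    Ck_bound m M L U \<Longrightarrow> Ck_bound m M H U \<Longrightarrow> Ck_bound m N A U"
    using Suc.IH[of K p a M] by blast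
  define g where "g = (M * a + M) / (1 - q)"
  define M' where "M' = max (2 * K * N + M) (2 ^ m * (1 * M * N) + M)"
  \<comment> \<open>With \<open>K = 0\<close> the smallness condition reads \<open>l \<le> q\<close>
    for every bound \<open>g\<close>, so large derivatives are allowed and the domain need not
    shrink.\<close>
  obtain N' where N': "\<And>(b :: 'v \<Rightarrow> 'v \<Rightarrow> 'v) L l H A.
    ray_eq U b 0 L l H \<Longrightarrow> ray_eq.solves U b L H (Suc p) A \<Longrightarrow> \<forall>u\<in>U. norm (A u) \<le> g \<Longrightarrow> 4 * 0 * g + l \<le> q \<Longrightarrow>
    Ck_bound m M' L U \<Longrightarrow> Ck_bound m M' H U \<Longrightarrow> Ck_bound m N' A U"
    using Suc.IH[of 0 "Suc p" g M'] by blast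
  have "Ck_bound (Suc m) (max N N') A U"
    if req: "ray_eq U b K L l H" and sol: "ray_eq.solves U b L H p A" and a: "\<forall>u\<in>U. norm (A u) \<le> a"
      and q: "4 * K * a + l \<le> q" and L: "Ck_bound (Suc m) M L U" and H: "Ck_bound (Suc m) M H U"
    for b :: "'v \<Rightarrow> 'v \<Rightarrow> 'v" and L l H A
  proof -
    interpret ray_eq U b K L l H by fact
    have a0: "0 \<le> a" using a nonempty_U norm_ge_zero order_trans by blast
    have M0: "0 \<le> M" using Ck_bound_0[OF H] nonempty_U norm_ge_zero order_trans by blast
    have A: "Ck_bound m N A U"
      by (rule N[OF req sol a q Ck_bound_SucD[OF L] Ck_bound_SucD[OF H]])
    have N0: "0 \<le> N" using Ck_bound_0[OF A] nonempty_U norm_ge_zero order_trans by blast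
    have "\<exists>D. has_dir_deriv (axis i 1) A D U \<and> Ck_bound m N' D U" for i
    proof -
      obtain DL DH where D: "has_dir_deriv (axis i 1) L DL U" "Ck_bound m M DL U"
        "has_dir_deriv (axis i 1) H DH U" "Ck_bound m M DH U"
        using L H by (meson Ck_bound.simps(2))
      obtain G where G: "has_dir_deriv (axis i 1) A G U"
        "ray_eq.solves U (\<lambda>x y. 0) (\<lambda>u. bsym (A u) + L u) (\<lambda>u. blinfun_apply (DL u) (A u) + DH u) (Suc p) G"
        "\<And>u. u \<in> U \<Longrightarrow> norm (G u) \<le> (M * a + M) / (1 - q)"
        using solves_has_dir_deriv[OF sol _ q \<open>q < 1\<close>, of DL "axis i 1" M DH] a D Ck_bound_0[OF D(2)] Ck_bound_0[OF D(4)]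
        by blast
      have "Ck_bound m N' G U"
      proof (rule N'[OF linearised_ray_eq G(2)])
        show "continuous_on U A" "continuous_on U DL" "continuous_on U DH"
          using sol Ck_bound_0[OF D(2)] Ck_bound_0[OF D(4)] by (auto simp: solves_def)
        show "\<forall>u\<in>U. norm (G u) \<le> g" using G(3) by (simp add: g_def)
        show "4 * 0 * g + (2 * K * a + l) \<le> q" using q mult_nonneg_nonneg[OF K_nonneg a0] by simp
        have "Ck_bound m (2 * K * N + M) (\<lambda>u. bsym (A u) + L u) U"
          by (intro Ck_bound_add Ck_bound_linear[OF bounded_linear_bsym norm_bsym] A Ck_bound_SucD[OF L]) (use K_nonneg in auto)
        then show "Ck_bound m M' (\<lambda>u. bsym (A u) + L u) U"
          by (rule Ck_bound_mono) (simp add: M'_def)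
        have "Ck_bound m (2 ^ m * (1 * M * N) + M) (\<lambda>u. blinfun_apply (DL u) (A u) + DH u) U"
          by (intro Ck_bound_add Ck_bound_bilinear[OF bounded_bilinear_blinfun_apply] A D M0 N0) (auto intro: norm_blinfun)
        then show "Ck_bound m M' (\<lambda>u. blinfun_apply (DL u) (A u) + DH u) U"
          by (rule Ck_bound_mono) (simp add: M'_def)
      qed (use a in auto)
      then show ?thesis using G(1) by blast
    qed
    then show ?thesis
      using Ck_bound_0[OF A] Ck_bound_mono[OF _ max.cobounded2[of N' N]]
      by (intro Ck_bound_SucI) (auto simp: le_max_iff_disj, blast)
  qed
  then show ?case by blast
qed

section \<open>Translation between \<open>Ck_bound\<close> and iterated partial derivatives\<close>

lemma pderivs_append: "pderivs (\<beta> @ \<beta>') f = pderivs \<beta> (pderivs \<beta>' f)"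
  by (induction \<beta>) auto

lemma pderivs_cong:
  assumes "open U" "\<And>u. u \<in> U \<Longrightarrow> f u = g u"
  shows "u \<in> U \<Longrightarrow> pderivs \<beta> f u = pderivs \<beta> g u"
proof (induction \<beta> arbitrary: u)
  case (Cons i \<beta>)
  obtain \<delta> where \<delta>: "\<delta> > 0" "\<And>t. \<bar>t\<bar> < \<delta> \<Longrightarrow> u + t *\<^sub>R axis i 1 \<in> U"
    using open_line_nbhd[OF assms(1) Cons.prems] by metis
  have "\<forall>\<^sub>F t in nhds 0. pderivs \<beta> f (u + t *\<^sub>R axis i 1) = pderivs \<beta> g (u + t *\<^sub>R axis i 1)"
    using \<delta> Cons.IH by (auto simp: eventually_nhds_metric dist_real_def intro!: exI[of _ \<delta>])
  then show ?case by (simp add: deriv_cong_ev)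
qed (use assms in auto)

lemma has_dir_deriv_pderivs:
  assumes "has_dir_deriv (axis i 1) f D U" "u \<in> U"
  shows "pderivs [i] f u = D u"
  using assms by (auto simp: has_dir_deriv_def has_real_derivative_iff_has_vector_derivative[symmetric] intro: DERIV_imp_deriv)

text \<open>The last entry of the index list is the derivative taken first, so the recursion of
  \<open>Ck_bound\<close> corresponds to lists of the form \<open>\<beta> @ [i]\<close>.\<close>

lemma is_Cm_imp_Ck_bound:
  assumes "is_Cm m f U" "\<And>\<beta> u. length \<beta> \<le> m \<Longrightarrow> u \<in> U \<Longrightarrow> \<bar>pderivs \<beta> f u\<bar> \<le> M"
  shows "Ck_bound m M f U"
  using assms
proof (induction m arbitrary: f)
  case 0
  then show ?case using "0"(1)[unfolded is_Cm_def] "0"(2)[of "[]"] by auto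
next
  case (Suc m)
  have c: "continuous_on U (pderivs \<beta> f)" if "length \<beta> \<le> Suc m" for \<beta>
    using Suc.prems(1) that by (auto simp: is_Cm_def)
  have d: "(\<lambda>t. pderivs \<beta> f (x + t *\<^sub>R axis i 1)) differentiable (at 0)" if "length \<beta> < Suc m" "x \<in> U" for \<beta> x i
    using Suc.prems(1) that by (auto simp: is_Cm_def)
  have "has_dir_deriv (axis i 1) f (pderivs [i] f) U" for i
    unfolding has_dir_deriv_def
  proof
    fix u assume "u \<in> U"
    then have "(\<lambda>t. f (u + t *\<^sub>R axis i 1)) differentiable (at 0)" using d[of "[]" u i] by simp
    then show "((\<lambda>t. f (u + t *\<^sub>R axis i 1)) has_vector_derivative pderivs [i] f u) (at 0)"
      by (simp add: has_real_derivative_iff_has_vector_derivative[symmetric] DERIV_deriv_iff_real_differentiable)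
  qed
  moreover have "Ck_bound m M (pderivs [i] f) U" for i
  proof (rule Suc.IH)
    show "is_Cm m (pderivs [i] f) U"
      unfolding is_Cm_def
      using c[of "\<beta> @ [i]" for \<beta>] d[of "\<beta> @ [i]" for \<beta>] by (auto simp: pderivs_append simp del: pderivs.simps)
    show "\<bar>pderivs \<beta> (pderivs [i] f) u\<bar> \<le> M" if "length \<beta> \<le> m" "u \<in> U" for \<beta> u
      using Suc.prems(2)[of "\<beta> @ [i]" u] that by (simp add: pderivs_append del: pderivs.simps)
  qed
  ultimately show ?case using c[of "[]"] Suc.prems(2)[of "[]"] by (auto simp del: pderivs.simps(2))
qed

text \<open>Induction from the end of the list, where the innermost derivative stands. The witness
  \<open>D\<close> agrees with the true partial derivative only on \<open>U\<close>, so openness of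
  \<open>U\<close> is what lets further derivatives be compared.\<close>

lemma Ck_bound_pderivs:
  assumes U: "open U" and f: "Ck_bound (length \<beta> + m) M f U"
  shows "Ck_bound m M (pderivs \<beta> f) U"
  using f
proof (induction \<beta> arbitrary: f rule: rev_induct)
  case (snoc i \<beta>)
  have "Ck_bound (Suc (length \<beta> + m)) M f U" using snoc.prems by (simp del: Ck_bound.simps)
  then obtain D where D: "has_dir_deriv (axis i 1) f D U" "Ck_bound (length \<beta> + m) M D U" by (rule Ck_bound_SucE)
  have "Ck_bound m M (pderivs \<beta> D) U" by (rule snoc.IH[OF D(2)])
  then show ?case
    unfolding pderivs_append
    by (rule Ck_bound_cong[OF U]) (use has_dir_deriv_pderivs[OF D(1)] in \<open>auto intro: pderivs_cong[OF U, symmetric] simp del: pderivs.simps\<close>)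
qed simp

lemma Ck_bound_antimono: "Ck_bound n M f U \<Longrightarrow> m \<le> n \<Longrightarrow> Ck_bound m M f U"
  by (induction n) (auto simp: le_Suc_eq simp del: Ck_bound.simps dest: Ck_bound_SucD)

lemma Ck_bound_imp_is_Cm:
  fixes f :: "real^'k \<Rightarrow> real"
  assumes U: "open U" and f: "Ck_bound m M f U"
  shows "is_Cm m f U" "length \<beta> \<le> m \<Longrightarrow> u \<in> U \<Longrightarrow> \<bar>pderivs \<beta> f u\<bar> \<le> M"
proof -
  have *: "Ck_bound (m - length \<beta>) M (pderivs \<beta> f) U" if "length \<beta> \<le> m" for \<beta>
    by (rule Ck_bound_pderivs[OF U]) (use f that in simp)
  show "length \<beta> \<le> m \<Longrightarrow> u \<in> U \<Longrightarrow> \<bar>pderivs \<beta> f u\<bar> \<le> M"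
    using Ck_bound_0[OF *[of \<beta>]] by auto
  show "is_Cm m f U"
    unfolding is_Cm_def
  proof (intro conjI allI impI ballI)
    fix \<beta> :: "'k list" assume "length \<beta> \<le> m"
    then show "continuous_on U (pderivs \<beta> f)" using Ck_bound_0[OF *[of \<beta>]] by auto
  next
    fix \<beta> :: "'k list" and x i assume "length \<beta> < m" "x \<in> U"
    then have "Ck_bound (Suc 0) M (pderivs \<beta> f) U"
      by (intro Ck_bound_antimono[OF *[of \<beta>]]) auto
    then obtain D where "has_dir_deriv (axis i 1) (pderivs \<beta> f) D U" by (rule Ck_bound_SucE)
    then show "(\<lambda>t. pderivs \<beta> f (x + t *\<^sub>R axis i 1)) differentiable (at 0)"
      using \<open>x \<in> U\<close> by (auto simp: has_dir_deriv_def has_vector_derivative_def differentiable_def)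
  qed
qed

section \<open>The exponential map\<close>

text \<open>A first-exit argument: as long as \<open>e\<close> stays below the barrier \<open>\<alpha> exp ((\<beta> + 1) t)\<close>, it
  moves more slowly than the barrier does, and it starts \<open>\<alpha>\<close> below it.\<close>

lemma gronwall_barrier:
  fixes e :: "real \<Rightarrow> 'a::real_normed_vector"
  assumes cont: "continuous_on {0..T} e" and e0: "e 0 = 0"
    and deriv: "\<And>t. 0 < t \<Longrightarrow> t < T \<Longrightarrow> (e has_vector_derivative e' t) (at t)"
    and bound: "\<And>t. 0 < t \<Longrightarrow> t < T \<Longrightarrow> norm (e t) < \<alpha> * exp ((\<beta> + 1) * t) \<Longrightarrow> norm (e' t) \<le> \<alpha> + \<beta> * norm (e t)"
    and \<alpha>: "0 < \<alpha>" and \<beta>: "0 \<le> \<beta>" and t: "t \<in> {0..T}"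
  shows "norm (e t) < \<alpha> * exp ((\<beta> + 1) * t)"
proof (rule ccontr)
  define \<Lambda> where "\<Lambda> t = \<alpha> * exp ((\<beta> + 1) * t)" for t
  define S where "S = {s \<in> {0..T}. \<Lambda> s \<le> norm (e s)}"
  assume "\<not> norm (e t) < \<alpha> * exp ((\<beta> + 1) * t)"
  then have "S \<noteq> {}" using t by (auto simp: S_def \<Lambda>_def not_less)
  have "continuous_on {0..T} \<Lambda>" unfolding \<Lambda>_def by (intro continuous_intros)
  then have "closed S" unfolding S_def
    by (intro continuous_on_closed_Collect_le continuous_intros cont) auto
  then have "compact S" by (auto simp: compact_eq_bounded_closed S_def intro: bounded_subset[OF bounded_closed_interval])
  then obtain \<tau> where \<tau>: "\<tau> \<in> S" "\<And>s. s \<in> S \<Longrightarrow> \<tau> \<le> s"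
    using compact_attains_inf[OF _ \<open>S \<noteq> {}\<close>] by auto
  have "0 \<notin> S" using \<alpha> e0 by (simp add: S_def \<Lambda>_def)
  then have pos: "0 < \<tau>" and \<tau>T: "\<tau> \<le> T" using \<tau>(1) by (auto simp: S_def intro: le_neq_trans)
  have below: "norm (e s) < \<Lambda> s" if "0 < s" "s < \<tau>" for s
    using \<tau>(2)[of s] that \<tau>T by (auto simp: S_def not_le[symmetric])
  have "norm (e \<tau> - e 0) \<le> \<Lambda> \<tau> - \<Lambda> 0"
  proof (rule differentiable_bound_general[OF pos, where f' = e' and \<phi>' = "\<lambda>s. (\<beta> + 1) * \<Lambda> s"])
    show "continuous_on {0..\<tau>} e" using cont \<tau>T by (auto intro: continuous_on_subset)
    show "continuous_on {0..\<tau>} \<Lambda>" unfolding \<Lambda>_def by (intro continuous_intros)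
    fix s assume s: "0 < s" "s < \<tau>"
    show "(e has_vector_derivative e' s) (at s)" using deriv s \<tau>T by auto
    show "(\<Lambda> has_vector_derivative (\<beta> + 1) * \<Lambda> s) (at s)"
      unfolding \<Lambda>_def has_real_derivative_iff_has_vector_derivative[symmetric]
      by (auto intro!: derivative_eq_intros)
    have "norm (e' s) \<le> \<alpha> + \<beta> * norm (e s)"
      using bound[of s] below[OF s] s \<tau>T by (auto simp: \<Lambda>_def)
    also have "\<dots> \<le> \<Lambda> s + \<beta> * \<Lambda> s"
    proof (intro add_mono mult_left_mono \<beta>)
      show "\<alpha> \<le> \<Lambda> s" using \<alpha> \<beta> s by (simp add: \<Lambda>_def)
      show "norm (e s) \<le> \<Lambda> s" using below[OF s] by simp
    qed
    finally show "norm (e' s) \<le> (\<beta> + 1) * \<Lambda> s" by (simp add: algebra_simps)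
  qed
  moreover have "\<Lambda> 0 = \<alpha>" by (simp add: \<Lambda>_def)
  ultimately show False using \<tau>(1) \<alpha> e0 by (auto simp: S_def)
qed

definition is_flow ::
  "(real^'n) set \<Rightarrow> ('k::finite \<Rightarrow> real^'n \<Rightarrow> real^'n) \<Rightarrow> real^'n \<Rightarrow> real^'k \<Rightarrow> (real \<Rightarrow> real^'n) \<Rightarrow> bool" where
  "is_flow \<Omega> X x0 u \<gamma> \<longleftrightarrow> \<gamma> 0 = x0 \<and> \<gamma> ` {0..1} \<subseteq> \<Omega> \<and>
      (\<forall>t\<in>{0..1}. (\<gamma> has_vector_derivative (\<Sum>j\<in>UNIV. u $ j *\<^sub>R X j (\<gamma> t))) (at t within {0..1}))"

definition C1_fields :: "(real^'n) set \<Rightarrow> ('k::finite \<Rightarrow> real^'n \<Rightarrow> real^'n) \<Rightarrow> bool" where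
  "C1_fields \<Omega> X \<longleftrightarrow> open \<Omega> \<and> (\<forall>j. (\<forall>x\<in>\<Omega>. X j differentiable (at x)) \<and>
          continuous_on \<Omega> (\<lambda>x. frechet_derivative (X j) (at x)))"

lemma C1_fields_continuous: "C1_fields \<Omega> X \<Longrightarrow> continuous_on \<Omega> (X j)"
  unfolding C1_fields_def
  by (meson continuous_at_imp_continuous_on differentiable_imp_continuous_within)

text \<open>Continuity of the derivative is meant in the topology of pointwise convergence, so each
  direction is bounded separately and the operator norm is estimated over a basis. The resulting
  \<open>M\<close> depends on the compact set; it serves only the qualitative facts that flows are
  unique and depend continuously on \<open>u\<close>.\<close>

lemma C1_fields_bounds:
  fixes X :: "'k::finite \<Rightarrow> real^'n \<Rightarrow> real^'n"
  assumes X: "C1_fields \<Omega> X" and S: "compact S" "S \<subseteq> \<Omega>"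
  obtains M where "M > 0" "\<And>j x. x \<in> S \<Longrightarrow> norm (X j x) \<le> M"
    "\<And>j x. x \<in> S \<Longrightarrow> onorm (frechet_derivative (X j) (at x)) \<le> M"
proof -
  have "\<exists>M. \<forall>x\<in>S. norm (X j x) \<le> M \<and> onorm (frechet_derivative (X j) (at x)) \<le> M" for j
  proof -
    have "bounded (X j ` S)"
      using C1_fields_continuous[OF X] S by (meson compact_continuous_image compact_imp_bounded continuous_on_subset)
    then obtain M0 where M0: "\<And>x. x \<in> S \<Longrightarrow> norm (X j x) \<le> M0" by (auto simp: bounded_iff)
    have "\<exists>N. \<forall>x\<in>S. norm (frechet_derivative (X j) (at x) v) \<le> N" for v
    proof -
      have "continuous_on \<Omega> (\<lambda>x. frechet_derivative (X j) (at x))" using X by (simp add: C1_fields_def)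
      from continuous_on_product_then_coordinatewise[OF continuous_on_subset[OF this S(2)]]
      have "continuous_on S (\<lambda>x. frechet_derivative (X j) (at x) v)" .
      then have "bounded ((\<lambda>x. frechet_derivative (X j) (at x) v) ` S)"
        using S by (meson compact_continuous_image compact_imp_bounded)
      then show ?thesis by (auto simp: bounded_iff)
    qed
    then obtain N where N: "\<And>v x. x \<in> S \<Longrightarrow> norm (frechet_derivative (X j) (at x) v) \<le> N v" by metis
    have "onorm (frechet_derivative (X j) (at x)) \<le> (\<Sum>v\<in>Basis. N v)" if "x \<in> S" for x
    proof -
      have "bounded_linear (frechet_derivative (X j) (at x))"
        using X S that by (auto simp: C1_fields_def frechet_derivative_works dest!: has_derivative_bounded_linear)
      from onorm_componentwise[OF this] show ?thesis
        using sum_mono[of Basis "\<lambda>v. norm (frechet_derivative (X j) (at x) v)" N] N[OF that] by auto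
    qed
    then have "\<forall>x\<in>S. norm (X j x) \<le> max M0 (\<Sum>v\<in>Basis. N v) \<and>
        onorm (frechet_derivative (X j) (at x)) \<le> max M0 (\<Sum>v\<in>Basis. N v)"
      using M0 by (auto simp: le_max_iff_disj)
    then show ?thesis by blast
  qed
  then obtain M where M: "\<And>j x. x \<in> S \<Longrightarrow> norm (X j x) \<le> M j \<and> onorm (frechet_derivative (X j) (at x)) \<le> M j"
    by metis
  have "M j \<le> (\<Sum>j\<in>UNIV. \<bar>M j\<bar>) + 1" for j
    using member_le_sum[of j UNIV "\<lambda>j. \<bar>M j\<bar>"] by simp
  then show thesis
    using M by (intro that[of "(\<Sum>j\<in>UNIV. \<bar>M j\<bar>) + 1"]) (auto intro: order_trans add_nonneg_pos sum_nonneg)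
qed

text \<open>The fields are Lipschitz only near the given trajectory. The barrier estimate asks for
  the differential inequality only while the two flows are close, so a Lipschitz bound on a compact
  neighbourhood suffices.\<close>

lemma flow_stable:
  fixes X :: "'k::finite \<Rightarrow> real^'n \<Rightarrow> real^'n"
  assumes X: "C1_fields \<Omega> X" and \<gamma>: "is_flow \<Omega> X x0 u \<gamma>" and \<epsilon>: "\<epsilon> > 0"
  obtains \<rho> where "\<rho> > 0" "\<And>v \<gamma>'. is_flow \<Omega> X x0 v \<gamma>' \<Longrightarrow> norm (v - u) < \<rho> \<Longrightarrow> norm (\<gamma>' 1 - \<gamma> 1) < \<epsilon>"
proof -
  have cont: "continuous_on {0..1} \<gamma>'" if "is_flow \<Omega> X x0 v \<gamma>'" for v \<gamma>'
    using that by (auto simp: is_flow_def intro!: continuous_on_vector_derivative)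
  have "compact (\<gamma> ` {0..1})" using cont[OF \<gamma>] by (intro compact_continuous_image) auto
  then obtain \<delta> where \<delta>: "\<delta> > 0" "(\<Union>x\<in>\<gamma> ` {0..1}. cball x \<delta>) \<subseteq> \<Omega>"
    using compact_subset_open_imp_cball_epsilon_subset[of "\<gamma> ` {0..1}" \<Omega>] X \<gamma> unfolding C1_fields_def is_flow_def by metis
  \<comment> \<open>The closed neighbourhood is written as a sum of two compact sets to obtain its
    compactness.\<close>
  let ?S = "{x + y |x y. x \<in> \<gamma> ` {0..1} \<and> y \<in> cball 0 \<delta>}"
  have S: "?S = (\<Union>x\<in>\<gamma> ` {0..1}. cball x \<delta>)"
  proof -
    have "z = x + (z - x) \<and> norm (z - x) \<le> \<delta>" if "dist x z \<le> \<delta>" for x z :: "real^'n"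
      using that by (simp add: dist_norm norm_minus_commute)
    then show ?thesis by (fastforce simp: dist_norm)
  qed
  have "compact ?S" by (rule compact_sums[OF \<open>compact (\<gamma> ` {0..1})\<close> compact_cball])
  then obtain M where M: "M > 0" "\<And>j x. x \<in> ?S \<Longrightarrow> norm (X j x) \<le> M"
    "\<And>j x. x \<in> ?S \<Longrightarrow> onorm (frechet_derivative (X j) (at x)) \<le> M"
    using C1_fields_bounds[OF X _ \<delta>(2)] unfolding S by metis
  define k where "k = real CARD('k)"
  have k: "k \<ge> 1" unfolding k_def by (simp add: Suc_leI)
  define \<beta> where "\<beta> = k * (M * (norm u + 1))"
  have \<beta>: "0 \<le> \<beta>" using M(1) k by (simp add: \<beta>_def)
  \<comment> \<open>On [0, 1] the barrier stays below both \<delta>, so that the second flow does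
    not leave the region where \<open>M\<close> is valid, and \<epsilon>, which is the claim at time
    1.\<close>
  define \<alpha> where "\<alpha> = min \<delta> \<epsilon> / exp (\<beta> + 1)"
  have \<alpha>: "\<alpha> > 0" using \<delta> \<epsilon> by (simp add: \<alpha>_def)
  \<comment> \<open>The 1 bounds the components of \<open>v\<close> by \<open>norm u + 1\<close>;
    the other entry keeps the forcing term \<open>norm (v - u) * (k * M)\<close> below
    \<alpha>.\<close>
  define \<rho> where "\<rho> = min 1 (\<alpha> / (k * M))"
  show thesis
  proof
    show "\<rho> > 0" using \<alpha> M(1) k by (simp add: \<rho>_def)
    fix v \<gamma>' assume \<gamma>': "is_flow \<Omega> X x0 v \<gamma>'" and v: "norm (v - u) < \<rho>"
    define e where "e t = \<gamma>' t - \<gamma> t" for t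
    define e' where "e' t = (\<Sum>j\<in>UNIV. v $ j *\<^sub>R X j (\<gamma>' t)) - (\<Sum>j\<in>UNIV. u $ j *\<^sub>R X j (\<gamma> t))" for t
    have "norm (e 1) < \<alpha> * exp ((\<beta> + 1) * 1)"
    proof (rule gronwall_barrier[where T = 1 and e' = e'])
      show "continuous_on {0..1} e" unfolding e_def by (intro continuous_intros cont[OF \<gamma>] cont[OF \<gamma>'])
      show "e 0 = 0" using \<gamma> \<gamma>' by (simp add: e_def is_flow_def)
      fix t :: real assume t: "0 < t" "t < 1"
      have "at t within {0..1} = at t" using t by (intro at_within_interior) auto
      then show "(e has_vector_derivative e' t) (at t)"
        unfolding e_def e'_def using \<gamma> \<gamma>' t
        by (intro has_vector_derivative_diff) (auto simp: is_flow_def dest!: bspec[of _ _ t])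
      assume lt: "norm (e t) < \<alpha> * exp ((\<beta> + 1) * t)"
      also have "\<dots> \<le> \<alpha> * exp (\<beta> + 1)" using \<alpha> \<beta> t by (simp add: mult_left_le)
      also have "\<dots> \<le> \<delta>" by (simp add: \<alpha>_def)
      finally have near: "norm (e t) \<le> \<delta>" by simp
      have cball: "cball (\<gamma> t) \<delta> \<subseteq> ?S" unfolding S using t by (intro UN_upper) auto
      have "norm (v $ j *\<^sub>R X j (\<gamma>' t) - u $ j *\<^sub>R X j (\<gamma> t)) \<le> norm (v - u) * M + (norm u + 1) * (M * norm (e t))" for j
      proof -
        have "v $ j *\<^sub>R X j (\<gamma>' t) - u $ j *\<^sub>R X j (\<gamma> t) = (v - u) $ j *\<^sub>R X j (\<gamma> t) + v $ j *\<^sub>R (X j (\<gamma>' t) - X j (\<gamma> t))"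
          by (simp add: algebra_simps)
        also have "norm \<dots> \<le> norm (v - u) * M + (norm u + 1) * (M * norm (e t))"
        proof (intro norm_triangle_mono)
          have "norm (X j (\<gamma> t)) \<le> M" using \<delta>(1) by (intro M(2) subsetD[OF cball]) simp
          then show "norm ((v - u) $ j *\<^sub>R X j (\<gamma> t)) \<le> norm (v - u) * M"
            using component_le_norm_cart[of "v - u" j] unfolding norm_scaleR real_norm_def by (intro mult_mono) auto
          have "norm (X j (\<gamma>' t) - X j (\<gamma> t)) \<le> M * norm (\<gamma>' t - \<gamma> t)"
          proof (rule differentiable_bound[OF convex_cball[of "\<gamma> t" \<delta>]])
            fix x assume x: "x \<in> cball (\<gamma> t) \<delta>"
            have "cball (\<gamma> t) \<delta> \<subseteq> \<Omega>" using cball \<delta>(2) unfolding S by (rule subset_trans)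
            then have "x \<in> \<Omega>" using x by (rule subsetD)
            then show "(X j has_derivative frechet_derivative (X j) (at x)) (at x within cball (\<gamma> t) \<delta>)"
              using X by (auto simp: C1_fields_def frechet_derivative_works[symmetric] intro: has_derivative_at_withinI)
            show "onorm (frechet_derivative (X j) (at x)) \<le> M" by (rule M(3)[OF subsetD[OF cball x]])
          qed (use near \<delta>(1) in \<open>auto simp: e_def dist_norm norm_minus_commute\<close>)
          moreover have "\<bar>v $ j\<bar> \<le> norm u + 1"
            using component_le_norm_cart[of v j] norm_triangle_sub[of v u] v by (simp add: \<rho>_def)
          ultimately show "norm (v $ j *\<^sub>R (X j (\<gamma>' t) - X j (\<gamma> t))) \<le> (norm u + 1) * (M * norm (e t))"
            unfolding norm_scaleR real_norm_def e_def by (intro mult_mono) auto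
        qed
        finally show ?thesis .
      qed
      then have "norm (\<Sum>j\<in>UNIV. v $ j *\<^sub>R X j (\<gamma>' t) - u $ j *\<^sub>R X j (\<gamma> t))
        \<le> of_nat (card (UNIV :: 'k set)) * (norm (v - u) * M + (norm u + 1) * (M * norm (e t)))"
        by (intro sum_norm_bound) auto
      then have "norm (e' t) \<le> k * (norm (v - u) * M + (norm u + 1) * (M * norm (e t)))"
        by (simp add: e'_def sum_subtractf k_def)
      also have "\<dots> = norm (v - u) * (k * M) + \<beta> * norm (e t)" by (simp add: \<beta>_def algebra_simps)
      also have "norm (v - u) * (k * M) \<le> \<alpha>"
        using v M(1) k by (simp add: \<rho>_def pos_less_divide_eq)
      finally show "norm (e' t) \<le> \<alpha> + \<beta> * norm (e t)" by simp
    qed (use \<alpha> \<beta> in auto)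
    also have "\<dots> \<le> \<epsilon>" by (simp add: \<alpha>_def)
    finally show "norm (\<gamma>' 1 - \<gamma> 1) < \<epsilon>" by (simp add: e_def)
  qed
qed

text \<open>Stability with equal parameters forces equal endpoints, so the definite description in
  \<open>Phi\<close> denotes the endpoint of any flow.\<close>

lemma Phi_eq:
  assumes X: "C1_fields \<Omega> X" and \<gamma>: "is_flow \<Omega> X x0 u \<gamma>"
  shows "Phi \<Omega> X x0 u = \<gamma> 1"
proof -
  have uniq: "\<gamma>' 1 = \<gamma> 1" if \<gamma>': "is_flow \<Omega> X x0 u \<gamma>'" for \<gamma>'
  proof (rule ccontr)
    assume "\<gamma>' 1 \<noteq> \<gamma> 1"
    then have "norm (\<gamma>' 1 - \<gamma> 1) > 0" by simp
    then obtain \<rho> where "\<rho> > 0" "\<And>v \<gamma>''. is_flow \<Omega> X x0 v \<gamma>'' \<Longrightarrow> norm (v - u) < \<rho> \<Longrightarrow> norm (\<gamma>'' 1 - \<gamma> 1) < norm (\<gamma>' 1 - \<gamma> 1)"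
      using flow_stable[OF X \<gamma>] by blast
    from this(2)[OF \<gamma>'] this(1) show False by simp
  qed
  have "(THE y. \<exists>\<gamma>. is_flow \<Omega> X x0 u \<gamma> \<and> \<gamma> 1 = y) = \<gamma> 1"
  proof (rule the_equality)
    show "\<exists>\<gamma>'. is_flow \<Omega> X x0 u \<gamma>' \<and> \<gamma>' 1 = \<gamma> 1" using \<gamma> by blast
    fix y assume "\<exists>\<gamma>'. is_flow \<Omega> X x0 u \<gamma>' \<and> \<gamma>' 1 = y"
    then show "y = \<gamma> 1" using uniq by blast
  qed
  moreover have "Phi \<Omega> X x0 u = (THE y. \<exists>\<gamma>. is_flow \<Omega> X x0 u \<gamma> \<and> \<gamma> 1 = y)"
    unfolding Phi_def is_flow_def by (rule arg_cong[where f = The], rule ext, rule arg_cong[where f = Ex], rule ext) blast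
  ultimately show ?thesis by simp
qed

lemma continuous_on_Phi:
  assumes X: "C1_fields \<Omega> X" and ex: "\<And>u. u \<in> V \<Longrightarrow> \<exists>\<gamma>. is_flow \<Omega> X x0 u \<gamma>"
  shows "continuous_on V (Phi \<Omega> X x0)"
  unfolding continuous_on_iff
proof (intro ballI allI impI)
  fix u \<epsilon> assume u: "u \<in> V" and \<epsilon>: "(0::real) < \<epsilon>"
  obtain \<gamma> where \<gamma>: "is_flow \<Omega> X x0 u \<gamma>" using ex[OF u] by blast
  obtain \<rho> where \<rho>: "\<rho> > 0" "\<And>v \<gamma>'. is_flow \<Omega> X x0 v \<gamma>' \<Longrightarrow> norm (v - u) < \<rho> \<Longrightarrow> norm (\<gamma>' 1 - \<gamma> 1) < \<epsilon>"
    using flow_stable[OF X \<gamma> \<epsilon>] by blast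
  have "dist (Phi \<Omega> X x0 v) (Phi \<Omega> X x0 u) < \<epsilon>" if "v \<in> V" "dist v u < \<rho>" for v
  proof -
    obtain \<gamma>' where \<gamma>': "is_flow \<Omega> X x0 v \<gamma>'" using ex[OF \<open>v \<in> V\<close>] by blast
    show ?thesis using \<rho>(2)[OF \<gamma>'] that unfolding Phi_eq[OF X \<gamma>] Phi_eq[OF X \<gamma>'] dist_norm by simp
  qed
  then show "\<exists>d>0. \<forall>v\<in>V. dist v u < d \<longrightarrow> dist (Phi \<Omega> X x0 v) (Phi \<Omega> X x0 u) < \<epsilon>"
    using \<rho>(1) by blast
qed

text \<open>The flow of the constant combination \<open>u\<close> is the path steered by the constant control
  with components \<open>u $ j / \<xi> powr d j\<close>.\<close>

lemma flow_exists:
  fixes X :: "'k::finite \<Rightarrow> real^'n \<Rightarrow> real^'n"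
  assumes set: "setting \<Omega> X d \<xi> x0 c dmin dmax ximin CX Cc" and "0 < dmin" "0 < ximin" and u: "norm u < ximin powr dmax"
  shows "\<exists>\<gamma>. is_flow \<Omega> X x0 u \<gamma> \<and> \<gamma> 1 \<in> ballXd \<Omega> X d \<xi> x0"
proof -
  have X: "C1_fields \<Omega> X" and d: "\<And>j. d j \<le> dmax" and \<xi>: "ximin \<le> \<xi>" "0 < \<xi>" "\<xi> \<le> 1" and C: "condC \<Omega> X d \<xi> x0"
    and dmin: "\<And>j. dmin \<le> d j"
    using set by (auto simp: setting_def C1_fields_def)
  \<comment> \<open>An admissible lower bound for all \<open>\<xi> powr d j\<close>, because
    \<open>ximin \<le> \<xi> \<le> 1\<close> and \<open>d j \<le> dmax\<close>. It makes the
    constant control shorter than 1.\<close>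
  define R where "R = ximin powr dmax"
  have R: "R > 0" using assms by (simp add: R_def)
  have le: "R \<le> \<xi> powr d j" for j
  proof -
    have "R \<le> ximin powr d j" unfolding R_def using \<xi> \<open>0 < ximin\<close> d by (intro powr_mono') auto
    also have "\<dots> \<le> \<xi> powr d j"
      using \<xi> \<open>0 < ximin\<close> dmin[of j] \<open>0 < dmin\<close> by (intro powr_mono2) auto
    finally show ?thesis .
  qed
  define a :: "real^'k" where "a = (\<chi> j. u $ j / \<xi> powr d j)"
  have a: "a $ j * \<xi> powr d j = u $ j" for j using \<xi> by (simp add: a_def)
  have "norm a \<le> norm ((1 / R) *\<^sub>R u)"
  proof (rule norm_le_componentwise_cart)
    fix j show "norm (a $ j) \<le> norm (((1 / R) *\<^sub>R u) $ j)"
      using le[of j] R \<xi> by (simp add: a_def frac_le)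
  qed
  also have "\<dots> < 1" using u R by (simp add: R_def)
  finally have "adm_ctrl (\<lambda>t. a)" unfolding adm_ctrl_def by (auto intro!: exI[of _ "norm a"])
  then obtain \<gamma> where \<gamma>: "ctrl_path \<Omega> X d \<xi> x0 (\<lambda>t. a) \<gamma>" using C by (auto simp: condC_def)
  define f where "f s = (\<Sum>j\<in>UNIV. u $ j *\<^sub>R X j (\<gamma> s))" for s
  have \<Omega>: "\<gamma> ` {0..1} \<subseteq> \<Omega>" and int: "\<And>t. t \<in> {0..1} \<Longrightarrow> (f has_integral (\<gamma> t - x0)) {0..t}"
    using \<gamma> by (auto simp: ctrl_path_def a f_def[abs_def])
  have \<gamma>_eq: "\<gamma> t = x0 + integral {0..t} f" if "t \<in> {0..1}" for t
    using integral_unique[OF int[OF that]] by simp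
  \<comment> \<open>A controlled path satisfies only an integral equation. As an indefinite integral
    it is continuous; hence the integrand is continuous, and the path is differentiable.\<close>
  have "continuous_on {0..1} (\<lambda>t. x0 + integral {0..t} f)"
    using int[of 1] by (intro continuous_intros indefinite_integral_continuous_1) auto
  then have cont: "continuous_on {0..1} \<gamma>" by (rule continuous_on_eq) (simp add: \<gamma>_eq)
  have contf: "continuous_on {0..1} f" unfolding f_def
    by (intro continuous_intros continuous_on_compose2[OF C1_fields_continuous[OF X] cont \<Omega>])
  have "(\<gamma> has_vector_derivative f t) (at t within {0..1})" if t: "t \<in> {0..1}" for t
  proof (rule has_vector_derivative_transform[OF t])
    show "((\<lambda>t. x0 + integral {0..t} f) has_vector_derivative f t) (at t within {0..1})"
      using has_vector_derivative_add[OF has_vector_derivative_const integral_has_vector_derivative[OF contf t], of x0] by simp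
  qed (simp add: \<gamma>_eq)
  moreover have "\<gamma> 0 = x0" using \<gamma>_eq[of 0] by simp
  ultimately have "is_flow \<Omega> X x0 u \<gamma>" using \<Omega> by (simp add: is_flow_def f_def)
  moreover have "\<gamma> 1 \<in> ballXd \<Omega> X d \<xi> x0"
    using \<gamma> \<open>adm_ctrl (\<lambda>t. a)\<close> by (auto simp: ballXd_def)
  ultimately show ?thesis by blast
qed

section \<open>Radial solutions\<close>

text \<open>Rescaling the average by \<open>r\<close> gives \<open>r A(r \<omega>)\<close> as an
  integral from 0 to \<open>r\<close>, to which the fundamental theorem applies. The larger radius
  \<open>T\<close> leaves room for a two-sided derivative.\<close>

lemma (in ray_eq) solves_radial_ode:
  assumes sol: "solves 0 A" and r: "0 < r" "r < T" and T: "T *\<^sub>R \<omega> \<in> U"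
  shows "((\<lambda>s. s *\<^sub>R A (s *\<^sub>R \<omega>)) has_vector_derivative rhs A (r *\<^sub>R \<omega>)) (at r)"
proof -
  define F where "F s = rhs A (s *\<^sub>R \<omega>)" for s
  have contr: "continuous_on U (rhs A)" using sol by (auto simp: solves_def intro: continuous_on_rhs)
  have inU: "s *\<^sub>R \<omega> \<in> U" if "s \<in> {0..T}" for s
  proof -
    have "s / T \<in> {0..1}" using that r by auto
    then have "(s / T) *\<^sub>R (T *\<^sub>R \<omega>) \<in> U" using star_U T unfolding star_at_0_def by blast
    then show ?thesis using r by simp
  qed
  have contF: "continuous_on {0..T} F" unfolding F_def
    by (rule continuous_on_compose2[OF contr]) (use inU in \<open>auto intro!: continuous_intros\<close>)
  have eq: "integral {0..s} F = s *\<^sub>R A (s *\<^sub>R \<omega>)" if s: "0 < s" "s < T" for s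
  proof -
    have "s *\<^sub>R \<omega> \<in> U" using inU s by auto
    then have "((\<lambda>x. F (s * x)) has_integral A (s *\<^sub>R \<omega>)) {0..1}"
      using has_integral_ray_avg[OF star_U contr, of "s *\<^sub>R \<omega>" 0] sol
      by (simp add: solves_def F_def mult.commute)
    moreover have "(\<lambda>x. x / s) ` {0..s} = {0..1}"
      using s image_divide_atLeastAtMost[of s 0 s] by simp
    ultimately show ?thesis
      using has_integral_stretch_real_iff[of s F "A (s *\<^sub>R \<omega>)" 0 s] s by (auto intro: integral_unique)
  qed
  have at: "at r within {0..T} = at r" using r by (intro at_within_interior) auto
  have "((\<lambda>s. integral {0..s} F) has_vector_derivative F r) (at r)"
    using integral_has_vector_derivative[OF contF, of r] r unfolding at by simp
  then have "((\<lambda>s. s *\<^sub>R A (s *\<^sub>R \<omega>)) has_vector_derivative F r) (at r)"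
    by (rule has_vector_derivative_transform_within_open[of _ _ _ "{0<..<T}"]) (use r eq in auto)
  then show ?thesis by (simp add: F_def)
qed

section \<open>Matrix products and comparison of matrix norms\<close>

lemma bounded_bilinear_matrix_mult: "bounded_bilinear ((**) :: real^'k^'k \<Rightarrow> real^'k^'k \<Rightarrow> real^'k^'k)"
  unfolding bilinear_conv_bounded_bilinear[symmetric] bilinear_def
  by (auto intro!: linearI simp: matrix_matrix_mult_def vec_eq_iff sum.distrib sum_distrib_left algebra_simps)

lemma matrix_mult_bound: "\<exists>K>0. \<forall>(M :: real^'k^'k) (N :: real^'k^'k). norm (M ** N) \<le> K * norm M * norm N"
  using bounded_bilinear.pos_bounded[OF bounded_bilinear_matrix_mult[where 'k = 'k]] by (simp only: mult_ac)

text \<open>The norm of the matrix type is the Euclidean norm of the entries, while solutions are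
  measured in operator norm. Here and in \<open>norm_le_opnorm\<close> the comparison constants
  depend only on the size of the matrices.\<close>

lemma opnorm_le_norm: "\<exists>c>0. \<forall>M :: real^'k^'k. opnorm M \<le> c * norm M"
proof -
  have "bounded_bilinear ((*v) :: real^'k^'k \<Rightarrow> real^'k \<Rightarrow> real^'k)"
    unfolding bilinear_conv_bounded_bilinear[symmetric] bilinear_def
    by (auto intro!: linearI simp: matrix_vector_mult_add_rdistrib matrix_vector_right_distrib
        scaleR_matrix_vector_assoc[symmetric] matrix_vector_mult_scaleR)
  then obtain c where c: "c > 0" "\<And>(M :: real^'k^'k) v. norm (M *v v) \<le> norm M * norm v * c"
    using bounded_bilinear.pos_bounded by blast
  have "opnorm M \<le> c * norm M" for M :: "real^'k^'k"
    unfolding opnorm_def by (rule onorm_bound) (use c in \<open>auto simp: mult_ac\<close>)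
  then show ?thesis using c(1) by blast
qed

lemma norm_vec_le_sum: "norm v \<le> (\<Sum>i\<in>UNIV. norm (v $ i))"
  unfolding norm_vec_def by (rule L2_set_le_sum) auto

lemma norm_mat_le:
  fixes M :: "real^'k^'k"
  assumes "\<And>i j. \<bar>M $ i $ j\<bar> \<le> B"
  shows "norm M \<le> real (CARD('k)) * (real (CARD('k)) * B)"
proof -
  have "norm (M $ i) \<le> real (CARD('k)) * B" for i
    using norm_vec_le_sum[of "M $ i"] sum_bounded_above[of UNIV "\<lambda>j. norm (M $ i $ j)" B] assms by auto
  then show ?thesis
    using norm_vec_le_sum[of M] sum_bounded_above[of UNIV "\<lambda>i. norm (M $ i)" "real (CARD('k)) * B"] by auto
qed

lemma norm_le_opnorm: "norm (M :: real^'k^'k) \<le> real (CARD('k)) * (real (CARD('k)) * opnorm M)"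
  by (rule norm_mat_le) (simp add: opnorm_def matrix_component_le_onorm)

section \<open>Uniqueness for the radial equation\<close>

lemma is_sol_continuous_ray:
  assumes "is_sol \<eta> \<Omega> X x0 c A" "norm \<omega> = 1" "T < \<eta>"
  shows "continuous_on {0..T} (\<lambda>r. A (r *\<^sub>R \<omega>))"
  by (rule continuous_on_compose2[of "ball 0 \<eta>" A])
     (use assms in \<open>auto simp: is_sol_def intro!: continuous_intros\<close>)

text \<open>The decay condition gives a linear bound only for \<open>r < \<delta>\<close>. On the
  rest of the segment \<open>A\<close> is bounded by some \<open>S\<close>, and
  \<open>S \<le> (S / \<delta>) * r\<close> there.\<close>

lemma is_sol_radial_bound:
  fixes A :: "real^'k \<Rightarrow> real^'k^'k"
  assumes sol: "is_sol \<eta> \<Omega> X x0 c A" and \<omega>: "norm \<omega> = 1" and T: "0 < T" "T < \<eta>"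
  obtains N where "0 \<le> N" "\<And>r. 0 < r \<Longrightarrow> r \<le> T \<Longrightarrow> norm (A (r *\<^sub>R \<omega>)) \<le> N * r"
proof -
  let ?k = "real CARD('k) * real CARD('k)"
  obtain K \<delta> where K: "\<delta> > 0" "\<And>r. r \<in> {0<..<\<delta>} \<Longrightarrow> opnorm (A (r *\<^sub>R \<omega>)) \<le> K * r"
    using sol \<omega> unfolding is_sol_def by metis
  have "bounded ((\<lambda>r. A (r *\<^sub>R \<omega>)) ` {0..T})"
    by (intro compact_imp_bounded compact_continuous_image is_sol_continuous_ray[OF sol \<omega> T(2)]) auto
  then obtain S where S: "\<And>r. r \<in> {0..T} \<Longrightarrow> norm (A (r *\<^sub>R \<omega>)) \<le> S"
    unfolding bounded_iff by blast
  have S0: "0 \<le> S" using order_trans[OF norm_ge_zero S[of 0]] T by simp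
  show thesis
  proof
    show "0 \<le> max (?k * \<bar>K\<bar>) (S / \<delta>)" by (simp add: le_max_iff_disj)
    fix r assume r: "0 < r" "r \<le> T"
    show "norm (A (r *\<^sub>R \<omega>)) \<le> max (?k * \<bar>K\<bar>) (S / \<delta>) * r"
    proof (cases "r < \<delta>")
      case True
      have "opnorm (A (r *\<^sub>R \<omega>)) \<le> \<bar>K\<bar> * r"
        using order_trans[OF K(2)[of r] mult_right_mono[OF abs_ge_self]] True r by simp
      then have "norm (A (r *\<^sub>R \<omega>)) \<le> ?k * (\<bar>K\<bar> * r)"
        using norm_le_opnorm[of "A (r *\<^sub>R \<omega>)"] by (auto simp: mult.assoc elim!: order_trans intro!: mult_left_mono)
      also have "\<dots> \<le> max (?k * \<bar>K\<bar>) (S / \<delta>) * r"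
        using r by (simp add: mult.assoc[symmetric] mult_right_mono)
      finally show ?thesis .
    next
      case False
      have "norm (A (r *\<^sub>R \<omega>)) \<le> S" using S r by auto
      also have "S \<le> (S / \<delta>) * r" using False S0 K(1) by (simp add: pos_le_divide_eq mult_left_mono)
      also have "\<dots> \<le> max (?k * \<bar>K\<bar>) (S / \<delta>) * r" using r by (intro mult_right_mono) auto
      finally show ?thesis .
    qed
  qed
qed

text \<open>For two solutions \<open>A\<close>, \<open>A'\<close> the function \<open>r (A - A')\<close> solves a linear equation along each ray.
  Its coefficients \<open>A / r\<close>, \<open>A' / r\<close> and \<open>C / r\<close> are bounded because of the decay condition at the origin.\<close>

lemma is_sol_unique:
  fixes A :: "real^'k \<Rightarrow> real^'k^'k"
  assumes A: "is_sol \<eta> \<Omega> X x0 c A" and A': "is_sol \<eta> \<Omega> X x0 c A'"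
    and C: "\<And>u. u \<in> ball 0 \<eta> \<Longrightarrow> norm (Cmat \<Omega> X x0 c u) \<le> D * norm u" and u: "u \<in> ball 0 \<eta>"
  shows "A' u = A u"
proof -
  have ray: "A' (T *\<^sub>R \<omega>) = A (T *\<^sub>R \<omega>)" if \<omega>: "norm \<omega> = 1" and T: "0 < T" "T < \<eta>" for \<omega> T
  proof -
    obtain N where N: "0 \<le> N" "\<And>r. 0 < r \<Longrightarrow> r \<le> T \<Longrightarrow> norm (A (r *\<^sub>R \<omega>)) \<le> N * r"
      using is_sol_radial_bound[OF A \<omega> T] by blast
    obtain N' where N': "0 \<le> N'" "\<And>r. 0 < r \<Longrightarrow> r \<le> T \<Longrightarrow> norm (A' (r *\<^sub>R \<omega>)) \<le> N' * r"
      using is_sol_radial_bound[OF A' \<omega> T] by blast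
    obtain K where K: "K > 0" "\<And>(M :: real^'k^'k) (M' :: real^'k^'k). norm (M ** M') \<le> K * norm M * norm M'"
      using matrix_mult_bound[where 'k = 'k] by blast
    define e where "e r = r *\<^sub>R (A' (r *\<^sub>R \<omega>) - A (r *\<^sub>R \<omega>))" for r
    define e' where "e' r = (- (A' (r *\<^sub>R \<omega>) ** A' (r *\<^sub>R \<omega>)) - Cmat \<Omega> X x0 c (r *\<^sub>R \<omega>) ** A' (r *\<^sub>R \<omega>) - Cmat \<Omega> X x0 c (r *\<^sub>R \<omega>))
      - (- (A (r *\<^sub>R \<omega>) ** A (r *\<^sub>R \<omega>)) - Cmat \<Omega> X x0 c (r *\<^sub>R \<omega>) ** A (r *\<^sub>R \<omega>) - Cmat \<Omega> X x0 c (r *\<^sub>R \<omega>))" for r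
    define \<beta> where "\<beta> = K * (N + N' + \<bar>D\<bar>)"
    have \<beta>: "0 \<le> \<beta>" using K(1) N(1) N'(1) by (simp add: \<beta>_def)
    have "norm (e T) < \<alpha> * exp ((\<beta> + 1) * T)" if \<alpha>: "0 < \<alpha>" for \<alpha>
    proof (rule gronwall_barrier[where e' = e'])
      show "continuous_on {0..T} e" unfolding e_def
        by (intro continuous_intros is_sol_continuous_ray[OF A \<omega> T(2)] is_sol_continuous_ray[OF A' \<omega> T(2)])
      fix t assume t: "0 < t" "t < T"
      have "((\<lambda>s. s *\<^sub>R A' (s *\<^sub>R \<omega>) - s *\<^sub>R A (s *\<^sub>R \<omega>)) has_vector_derivative e' t) (at t)"
        unfolding e'_def using A A' \<omega> t T unfolding is_sol_def by (intro has_vector_derivative_diff) auto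
      then show "(e has_vector_derivative e' t) (at t)" by (simp add: e_def[abs_def] scaleR_diff_right)
      define a where "a = A (t *\<^sub>R \<omega>)"
      define a' where "a' = A' (t *\<^sub>R \<omega>)"
      define C where "C = Cmat \<Omega> X x0 c (t *\<^sub>R \<omega>)"
      have "norm C \<le> D * t" using assms(3)[of "t *\<^sub>R \<omega>"] \<omega> t T by (simp add: C_def)
      also have "\<dots> \<le> \<bar>D\<bar> * t" using t by (intro mult_right_mono) auto
      finally have nC: "norm C \<le> \<bar>D\<bar> * t" .
      \<comment> \<open>The inhomogeneous terms cancel and every remaining term contains the factor
        \<open>a' - a\<close>. The bounds linear in \<open>t\<close> on the other factors turn it
        into \<open>t * norm (a' - a)\<close>, the norm of \<open>e t\<close>.\<close>
      have "e' t = - (a' ** (a' - a) + (a' - a) ** a + C ** (a' - a))"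
        unfolding e'_def a_def[symmetric] a'_def[symmetric] C_def[symmetric]
        by (simp add: bounded_bilinear.diff_left[OF bounded_bilinear_matrix_mult] bounded_bilinear.diff_right[OF bounded_bilinear_matrix_mult])
      also have "norm \<dots> \<le> K * norm a' * norm (a' - a) + K * norm (a' - a) * norm a + K * norm C * norm (a' - a)"
        unfolding norm_minus_cancel by (intro norm_triangle_mono K)
      also have "\<dots> = K * (norm a + norm a' + norm C) * norm (a' - a)" by (simp add: algebra_simps)
      also have "\<dots> \<le> K * (N * t + N' * t + \<bar>D\<bar> * t) * norm (a' - a)"
        using N(2)[of t] N'(2)[of t] nC t K(1) unfolding a_def a'_def
        by (intro mult_right_mono mult_left_mono add_mono) auto
      also have "\<dots> = \<beta> * (t * norm (a' - a))" by (simp add: \<beta>_def algebra_simps)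
      also have "t * norm (a' - a) = norm (e t)" using t by (simp add: e_def a_def a'_def)
      finally show "norm (e' t) \<le> \<alpha> + \<beta> * norm (e t)" using \<alpha> by simp
    qed (use \<alpha> \<beta> T in \<open>auto simp: e_def\<close>)
    \<comment> \<open>The strict bound holds for every positive \<alpha>; for this value it would
      say \<open>norm (e T) < norm (e T)\<close>.\<close>
    from this[of "norm (e T) / exp ((\<beta> + 1) * T)"] have "e T = 0" by (cases "e T = 0") auto
    then show ?thesis using T by (simp add: e_def)
  qed
  show ?thesis
  proof (cases "u = 0")
    case False
    then show ?thesis using ray[of "u /\<^sub>R norm u" "norm u"] u by simp
  next
    case True
    \<comment> \<open>The radial equation does not reach the origin, so equality there is carried
      over from a ray by continuity.\<close>
    obtain \<omega> :: "real^'k" where \<omega>: "norm \<omega> = 1" using vector_choose_size[of 1] by auto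
    have \<eta>: "\<eta> > 0" using u True by simp
    define f where "f r = A' (r *\<^sub>R \<omega>) - A (r *\<^sub>R \<omega>)" for r
    have "continuous_on {0..\<eta> / 2} f" unfolding f_def using \<eta>
      by (intro continuous_on_diff is_sol_continuous_ray[OF A \<omega>] is_sol_continuous_ray[OF A' \<omega>]) auto
    then have "(f \<longlongrightarrow> f 0) (at 0 within {0..\<eta> / 2})" using \<eta> by (simp add: continuous_on_def)
    then have "(f \<longlongrightarrow> f 0) (at_right 0)" using at_within_Icc_at_right[of 0 "\<eta> / 2"] \<eta> by simp
    moreover have "\<forall>\<^sub>F r in at_right 0. f r = 0"
      by (rule eventually_at_rightI[of 0 \<eta>]) (use ray[OF \<omega>] \<eta> in \<open>auto simp: f_def\<close>)
    then have "(f \<longlongrightarrow> 0) (at_right 0)" by (rule tendsto_eventually)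
    ultimately have "f 0 = 0" by (rule tendsto_unique[OF trivial_limit_at_right_real])
    then show ?thesis using True by (simp add: f_def)
  qed
qed

section \<open>Size and regularity of the matrix \<open>Cmat\<close>\<close>

lemma ctilde_on_ball:
  fixes c :: "'k::finite \<Rightarrow> 'k \<Rightarrow> 'k \<Rightarrow> real^'n \<Rightarrow> real"
  assumes set: "setting \<Omega> X d \<xi> x0 c dmin dmax ximin CX Cc" and pos: "0 < dmin" "0 < ximin"
  shows "continuous_on (ball 0 (ximin powr dmax)) (ctilde \<Omega> X x0 c i j k)"
    and "u \<in> ball 0 (ximin powr dmax) \<Longrightarrow> \<bar>ctilde \<Omega> X x0 c i j k u\<bar> \<le> Cc"
proof -
  let ?B = "ballXd \<Omega> X d \<xi> x0" and ?V = "ball 0 (ximin powr dmax) :: (real^'k) set"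
  have X: "C1_fields \<Omega> X" using set by (auto simp: setting_def C1_fields_def)
  have c: "continuous_on ?B (c i j k)" "\<And>x. x \<in> ?B \<Longrightarrow> \<bar>c i j k x\<bar> \<le> Cc"
    using set unfolding setting_def Let_def by blast+
  have ex: "\<exists>\<gamma>. is_flow \<Omega> X x0 u \<gamma> \<and> \<gamma> 1 \<in> ?B" if "u \<in> ?V" for u
    using flow_exists[OF set pos] that by simp
  \<comment> \<open>The bound \<open>Cc\<close> on the structure functions is available only on this
    set, which is why the endpoint's membership was recorded with the flow.\<close>
  have PhiB: "Phi \<Omega> X x0 u \<in> ?B" if "u \<in> ?V" for u
    using ex[OF that] Phi_eq[OF X] by metis
  have "continuous_on ?V (Phi \<Omega> X x0)" using ex by (intro continuous_on_Phi[OF X]) blast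
  then show "continuous_on ?V (ctilde \<Omega> X x0 c i j k)"
    unfolding ctilde_def[abs_def] using PhiB by (intro continuous_on_compose2[OF c(1)]) auto
  show "\<bar>ctilde \<Omega> X x0 c i j k u\<bar> \<le> Cc" if "u \<in> ?V"
    unfolding ctilde_def using c(2) PhiB that by blast
qed

text \<open>The explicit factors \<open>u $ j\<close> make the matrix vanish to first order at 0.
  One power of the dimension comes from the sum over \<open>j\<close>, two from passing from entries
  to the norm.\<close>

lemma norm_Cmat_le:
  fixes c :: "'k::finite \<Rightarrow> 'k \<Rightarrow> 'k \<Rightarrow> real^'n \<Rightarrow> real"
  assumes set: "setting \<Omega> X d \<xi> x0 c dmin dmax ximin CX Cc" and pos: "0 < dmin" "0 < ximin"
    and u: "u \<in> ball 0 (ximin powr dmax)"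
  shows "norm (Cmat \<Omega> X x0 c u) \<le> real CARD('k) ^ 3 * \<bar>Cc\<bar> * norm u"
proof -
  have "\<bar>Cmat \<Omega> X x0 c u $ i $ k\<bar> \<le> real CARD('k) * (norm u * \<bar>Cc\<bar>)" for i k
  proof -
    have "\<bar>u $ j * ctilde \<Omega> X x0 c i j k u\<bar> \<le> norm u * \<bar>Cc\<bar>" for j
      unfolding abs_mult using component_le_norm_cart[of u j] ctilde_on_ball(2)[OF set pos u, of i j k]
      by (intro mult_mono) auto
    then have "(\<Sum>j\<in>UNIV. \<bar>u $ j * ctilde \<Omega> X x0 c i j k u\<bar>) \<le> real CARD('k) * (norm u * \<bar>Cc\<bar>)"
      using sum_bounded_above[of UNIV "\<lambda>j. \<bar>u $ j * ctilde \<Omega> X x0 c i j k u\<bar>"] by blast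
    then show ?thesis unfolding Cmat_def by (auto intro: order_trans[OF sum_abs])
  qed
  from norm_mat_le[OF this] show ?thesis by (simp add: power3_eq_cube mult_ac)
qed

lemma continuous_on_Cmat:
  assumes "setting \<Omega> X d \<xi> x0 c dmin dmax ximin CX Cc" "0 < dmin" "0 < ximin"
  shows "continuous_on (ball 0 (ximin powr dmax)) (Cmat \<Omega> X x0 c)"
  unfolding Cmat_def[abs_def] by (intro continuous_intros ctilde_on_ball[OF assms])

lemma axis_linear:
  shows "bounded_linear (axis i :: 'b::real_normed_vector \<Rightarrow> 'b^'n)" and "norm (axis i x :: 'b^'n) \<le> norm x"
proof -
  have le: "norm (axis i x :: 'b^'n) \<le> norm x" for x
  proof -
    have "norm (axis i x :: 'b^'n) \<le> (\<Sum>j\<in>UNIV. if j = i then norm x else 0)"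
      using norm_vec_le_sum[of "axis i x :: 'b^'n"] by (simp add: axis_def if_distrib cong: if_cong)
    then show ?thesis by simp
  qed
  then show "norm (axis i x :: 'b^'n) \<le> norm x" .
  show "bounded_linear (axis i :: 'b \<Rightarrow> 'b^'n)"
    by (rule bounded_linear_intro[of _ 1]) (use le in \<open>auto simp: axis_def vec_eq_iff\<close>)
qed

text \<open>The vector is reassembled from its components by the linear maps \<open>axis i\<close>,
  each of norm at most 1. Applied twice it handles matrices.\<close>

lemma Ck_bound_vec:
  fixes f :: "real^'k \<Rightarrow> 'b::real_normed_vector^'n"
  assumes "\<And>i. Ck_bound m M (\<lambda>u. f u $ i) U"
  shows "Ck_bound m (\<Sum>i\<in>(UNIV::'n set). M) f U"
proof -
  have "Ck_bound m (\<Sum>i\<in>(UNIV::'n set). 1 * M) (\<lambda>u. \<Sum>i\<in>UNIV. axis i (f u $ i) :: 'b^'n) U"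
    by (intro Ck_bound_sum Ck_bound_linear[OF axis_linear(1)] assms) (auto simp: axis_linear(2))
  moreover have "(\<Sum>i\<in>UNIV. axis i (v $ i)) = v" for v :: "'b^'n"
    by (auto simp: vec_eq_iff axis_def if_distrib cong: if_cong)
  ultimately show ?thesis by simp
qed

lemma Ck_bound_Cmat:
  fixes c :: "'k::finite \<Rightarrow> 'k \<Rightarrow> 'k \<Rightarrow> real^'n \<Rightarrow> real" and U :: "(real^'k) set"
  assumes "\<And>i j k. Ck_bound m M (ctilde \<Omega> X x0 c i j k) U" "\<And>u. u \<in> U \<Longrightarrow> norm u \<le> R" "0 \<le> M"
  shows "Ck_bound m (\<Sum>i\<in>(UNIV::'k set). \<Sum>k\<in>(UNIV::'k set). \<Sum>j\<in>(UNIV::'k set). 2 ^ m * (1 * max R 1 * M)) (Cmat \<Omega> X x0 c) U"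
proof (intro Ck_bound_vec)
  fix i k
  have "Ck_bound m (\<Sum>j\<in>(UNIV::'k set). 2 ^ m * (1 * max R 1 * M)) (\<lambda>u. \<Sum>j\<in>UNIV. u $ j * ctilde \<Omega> X x0 c i j k u) U"
    by (intro Ck_bound_sum Ck_bound_bilinear[OF bounded_bilinear_mult] Ck_bound_component assms)
       (auto simp: abs_mult)
  then show "Ck_bound m (\<Sum>j\<in>(UNIV::'k set). 2 ^ m * (1 * max R 1 * M)) (\<lambda>u. Cmat \<Omega> X x0 c u $ i $ k) U"
    by (simp add: Cmat_def)
qed

text \<open>Left multiplication as an operator, so that the term C A fits the shape of the linear
  coefficient in \<open>ray_eq\<close>.\<close>

definition mat_left :: "real^'k^'k \<Rightarrow> (real^'k^'k) \<Rightarrow>\<^sub>L (real^'k^'k)" where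
  "mat_left = bounded_bilinear.prod_right (**)"

lemma mat_left_apply: "blinfun_apply (mat_left M) N = M ** N"
  by (simp add: mat_left_def bounded_bilinear.prod_right.rep_eq[OF bounded_bilinear_matrix_mult])

lemma bounded_linear_mat_left: "bounded_linear mat_left"
  unfolding mat_left_def by (rule bounded_bilinear.bounded_linear_prod_right[OF bounded_bilinear_matrix_mult])

lemma norm_mat_left_le:
  assumes "0 < K" "\<And>(M :: real^'k^'k) (N :: real^'k^'k). norm (M ** N) \<le> K * norm M * norm N"
  shows "norm (mat_left (M :: real^'k^'k)) \<le> K * norm M"
  by (rule norm_blinfun_bound) (use assms in \<open>auto simp: mat_left_apply\<close>)

lemma matrix_ray_eq:
  fixes C :: "real^'k \<Rightarrow> real^'k^'k"
  assumes K: "0 < K" "\<And>(M :: real^'k^'k) (N :: real^'k^'k). norm (M ** N) \<le> K * norm M * norm N"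
    and C: "continuous_on (ball 0 \<eta>) C" "\<And>u. u \<in> ball 0 \<eta> \<Longrightarrow> norm (C u) \<le> D * norm u" and "0 < \<eta>" "0 \<le> D"
  shows "ray_eq (ball 0 \<eta>) (\<lambda>M N. - (M ** N)) K (\<lambda>u. - mat_left (C u)) (K * (D * \<eta>)) (\<lambda>u. - C u)"
proof (rule ray_eq.intro)
  interpret bounded_bilinear "(**) :: real^'k^'k \<Rightarrow> real^'k^'k \<Rightarrow> real^'k^'k"
    by (rule bounded_bilinear_matrix_mult)
  show "bounded_bilinear (\<lambda>(M :: real^'k^'k) (N :: real^'k^'k). - (M ** N))"
    by (rule bounded_bilinear.intro) (use K in \<open>auto simp: add_left add_right scaleR_left scaleR_right intro!: exI[of _ K] simp: mult_ac\<close>)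
  show "norm (- mat_left (C u)) \<le> K * (D * \<eta>)" if "u \<in> ball 0 \<eta>" for u
  proof -
    have "norm (C u) \<le> D * \<eta>"
      using C(2)[OF that] that \<open>0 \<le> D\<close> mult_left_mono[of "norm u" \<eta> D] by simp
    then show ?thesis
      using norm_mat_left_le[OF K, of "C u"] K(1) by (auto elim!: order_trans)
  qed
  show "norm (- (M ** N)) \<le> K * norm M * norm N" for M N :: "real^'k^'k" using K(2) by simp
qed (use assms star_at_0_ball in \<open>auto intro!: continuous_intros bounded_linear.continuous_on[OF bounded_linear_mat_left]\<close>)

theorem theorem3p10:
  fixes \<kappa> dmin dmax ximin CX Cc :: real
  assumes "0 < \<kappa>" "\<kappa> \<le> 1/2" "0 < dmin" "0 < ximin"
  shows "\<exists>\<eta>1>0. \<exists>C.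
    (\<forall>(\<Omega>::(real^'n) set) (X::'k::finite \<Rightarrow> real^'n \<Rightarrow> real^'n) d \<xi> x0 c.
       setting \<Omega> X d \<xi> x0 c dmin dmax ximin CX Cc \<longrightarrow>
       (\<exists>A. is_sol \<eta>1 \<Omega> X x0 c A \<and>
            (\<forall>A'. is_sol \<eta>1 \<Omega> X x0 c A' \<longrightarrow> (\<forall>u\<in>ball 0 \<eta>1. A' u = A u)) \<and>
            (\<forall>u\<in>ball 0 \<eta>1. opnorm (A u) \<le> C * norm u) \<and>
            (\<forall>u\<in>ball 0 \<eta>1. opnorm (A u) \<le> \<kappa>))) \<and>
    (\<forall>(m::nat) Ct. \<exists>Cm.
      \<forall>(\<Omega>::(real^'n) set) (X::'k::finite \<Rightarrow> real^'n \<Rightarrow> real^'n) d \<xi> x0 c.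
        setting \<Omega> X d \<xi> x0 c dmin dmax ximin CX Cc \<longrightarrow>
        (\<forall>i j k. is_Cm m (ctilde \<Omega> X x0 c i j k) (ball 0 \<eta>1) \<and>
                 Cm_norm_le m (ctilde \<Omega> X x0 c i j k) (ball 0 \<eta>1) Ct) \<longrightarrow>
        (\<forall>A. is_sol \<eta>1 \<Omega> X x0 c A \<longrightarrow>
             (\<forall>i j. is_Cm m (\<lambda>u. A u $ i $ j) (ball 0 \<eta>1)) \<and>
             Cm_norm_le_mat m A (ball 0 \<eta>1) Cm))"
proof -
  obtain K where K: "K > 0" "\<And>(M :: real^'k^'k) (N :: real^'k^'k). norm (M ** N) \<le> K * norm M * norm N"
    using matrix_mult_bound[where 'k = 'k] by blast
  obtain \<nu> where \<nu>: "\<nu> > 0" "\<And>M :: real^'k^'k. opnorm M \<le> \<nu> * norm M"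
    using opnorm_le_norm[where 'k = 'k] by blast
  define D where "D = real CARD('k) ^ 3 * \<bar>Cc\<bar>"
  have D: "0 \<le> D" by (simp add: D_def)
  \<comment> \<open>The first entry gives the bound \<kappa> in operator norm, the second gives
    \<open>4 * K * a \<le> 1 / 4\<close>, half of the contraction budget 1/2.\<close>
  define a where "a = min (\<kappa> / \<nu>) (1 / (16 * K))"
  have a: "0 < a" "\<nu> * a \<le> \<kappa>" "K * a \<le> 1 / 16"
  proof -
    show "0 < a" using assms \<nu> K by (simp add: a_def)
    have "a \<le> \<kappa> / \<nu>" "a \<le> 1 / (16 * K)" by (simp_all add: a_def)
    then show "\<nu> * a \<le> \<kappa>" "K * a \<le> 1 / 16" using \<nu> K by (simp_all add: field_simps)
  qed
  \<comment> \<open>On the first radius all flows exist. The second makes the linear coefficient at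
    most 1/4, the other half of the budget. The third makes the source term at most
    \<open>a / 2\<close>, for the invariance condition. Writing \<open>D + 1\<close> avoids division
    by zero.\<close>
  define \<eta> where "\<eta> = min (ximin powr dmax) (min (1 / (4 * K * (D + 1))) (a / (2 * (D + 1))))"
  have \<eta>: "0 < \<eta>" "\<eta> \<le> ximin powr dmax" "K * (D * \<eta>) \<le> 1 / 4" "D * \<eta> \<le> a / 2"
  proof -
    show "0 < \<eta>" using assms K D a(1) by (simp add: \<eta>_def)
    show "\<eta> \<le> ximin powr dmax" by (simp add: \<eta>_def)
    have "\<eta> \<le> 1 / (4 * K * (D + 1))" "\<eta> \<le> a / (2 * (D + 1))" by (simp_all add: \<eta>_def)
    moreover have "0 < 4 * K * (D + 1)" "0 < 2 * (D + 1)" using K(1) D by simp_all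
    ultimately have "\<eta> * (4 * K * (D + 1)) \<le> 1" "\<eta> * (2 * (D + 1)) \<le> a" by (simp_all only: pos_le_divide_eq)
    then have "4 * (K * ((D + 1) * \<eta>)) \<le> 1" "2 * ((D + 1) * \<eta>) \<le> a" by (simp_all only: mult_ac)
    moreover have "D * \<eta> \<le> (D + 1) * \<eta>" using \<open>0 < \<eta>\<close> by simp
    moreover have "K * (D * \<eta>) \<le> K * ((D + 1) * \<eta>)" using \<open>D * \<eta> \<le> (D + 1) * \<eta>\<close> K(1) by (intro mult_left_mono) auto
    ultimately show "K * (D * \<eta>) \<le> 1 / 4" "D * \<eta> \<le> a / 2" by linarith+
  qed
  let ?U = "ball 0 \<eta> :: (real^'k) set"
  let ?b = "\<lambda>M N :: real^'k^'k. - (M ** N)"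
  have q: "4 * K * a + K * (D * \<eta>) \<le> 1 / 2" using a \<eta> by simp
  have C: "continuous_on ?U (Cmat \<Omega> X x0 c)" "\<And>u. u \<in> ?U \<Longrightarrow> norm (Cmat \<Omega> X x0 c u) \<le> D * norm u"
    if "setting \<Omega> X d \<xi> x0 c dmin dmax ximin CX Cc"
    for \<Omega> :: "(real^'n) set" and X :: "'k \<Rightarrow> real^'n \<Rightarrow> real^'n" and d \<xi> x0 c
    using continuous_on_subset[OF continuous_on_Cmat[OF that assms(3,4)] subset_ball[OF \<eta>(2)]]
      norm_Cmat_le[OF that assms(3,4)] \<eta>(2) by (auto simp: D_def)
  have req: "ray_eq ?U ?b K (\<lambda>u. - mat_left (Cmat \<Omega> X x0 c u)) (K * (D * \<eta>)) (\<lambda>u. - Cmat \<Omega> X x0 c u)"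
    if "setting \<Omega> X d \<xi> x0 c dmin dmax ximin CX Cc"
    for \<Omega> :: "(real^'n) set" and X :: "'k \<Rightarrow> real^'n \<Rightarrow> real^'n" and d \<xi> x0 c
    by (rule matrix_ray_eq[OF K C[OF that] \<eta>(1) D])
  \<comment> \<open>The integral form and the bound \<open>a\<close> are kept beside
    \<open>is_sol\<close>, since the regularity result speaks about small solutions of the integral
    equation.\<close>
  have main: "\<exists>A. is_sol \<eta> \<Omega> X x0 c A \<and>
      ray_eq.solves ?U ?b (\<lambda>u. - mat_left (Cmat \<Omega> X x0 c u)) (\<lambda>u. - Cmat \<Omega> X x0 c u) 0 A \<and>
      (\<forall>u\<in>?U. norm (A u) \<le> a) \<and> (\<forall>u\<in>?U. norm (A u) \<le> 2 * D * norm u)"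
    if set: "setting \<Omega> X d \<xi> x0 c dmin dmax ximin CX Cc"
    for \<Omega> :: "(real^'n) set" and X :: "'k \<Rightarrow> real^'n \<Rightarrow> real^'n" and d \<xi> x0 c
  proof -
    interpret ray_eq ?U ?b K "\<lambda>u. - mat_left (Cmat \<Omega> X x0 c u)" "K * (D * \<eta>)" "\<lambda>u. - Cmat \<Omega> X x0 c u"
      by (rule req[OF set])
    have Cle: "norm (Cmat \<Omega> X x0 c u) \<le> D * \<eta>" if "u \<in> ?U" for u
      using C(2)[OF set that] that D mult_left_mono[of "norm u" \<eta> D] by simp
    obtain A where A: "solves 0 A" "\<And>u. u \<in> ?U \<Longrightarrow> norm (A u) \<le> a"
    proof (rule solves_exists[where a = a and q = "1 / 2" and h = "D * \<eta>" and p = 0])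
      have "(K * a + K * (D * \<eta>)) * a \<le> (1 / 2) * a" using a \<eta> by (intro mult_right_mono) auto
      then show "(K * a + K * (D * \<eta>)) * a + D * \<eta> \<le> a" using \<eta>(4) by simp
      show "2 * K * a + K * (D * \<eta>) \<le> 1 / 2" using a \<eta> by simp
    qed (use a Cle in auto)
    have lin: "norm (A u) \<le> 2 * D * norm u" if u: "u \<in> ?U" for u
    proof -
      have "norm (A u) \<le> (D * norm u) / (1 - 1 / 2)"
      \<comment> \<open>On the closed ball of radius \<open>norm u\<close> the source is at most
        \<open>D * norm u\<close>, so localising the bound there yields decay linear in
        \<open>norm u\<close>.\<close>
      proof (rule solves_bound[OF A, where V = "cball 0 (norm u)"])
        show "K * a + K * (D * \<eta>) \<le> 1 / 2" using a \<eta> by simp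
        show "cball 0 (norm u) \<subseteq> ?U" using u by auto
        show "norm (- Cmat \<Omega> X x0 c v) \<le> D * norm u" if "v \<in> cball 0 (norm u)" for v
          using C(2)[OF set, of v] that u mult_left_mono[of "norm v" "norm u" D] D by simp
      qed (auto simp: star_at_0_cball)
      then show ?thesis by simp
    qed
    have "is_sol \<eta> \<Omega> X x0 c A"
      unfolding is_sol_def
    proof (intro conjI allI impI ballI)
      show "continuous_on ?U A" using A(1) by (simp add: solves_def)
      fix \<omega> :: "real^'k" assume \<omega>: "norm \<omega> = 1"
      show "\<exists>K \<delta>. 0 < \<delta> \<and> (\<forall>r\<in>{0<..<\<delta>}. opnorm (A (r *\<^sub>R \<omega>)) \<le> K * r)"
      proof (intro exI conjI ballI)
        fix r assume r: "r \<in> {0<..<\<eta>}"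
        have "norm (A (r *\<^sub>R \<omega>)) \<le> 2 * D * r" using lin[of "r *\<^sub>R \<omega>"] r \<omega> by simp
        then show "opnorm (A (r *\<^sub>R \<omega>)) \<le> (\<nu> * (2 * D)) * r"
          using order_trans[OF \<nu>(2) mult_left_mono[of _ _ \<nu>]] \<nu>(1) by (simp add: mult.assoc)
      qed (rule \<eta>(1))
      fix r assume r: "r \<in> {0<..<\<eta>}"
      then obtain T where T: "r < T" "T < \<eta>" using dense by auto
      have "T *\<^sub>R \<omega> \<in> ?U" using T r \<omega> by simp
      from solves_radial_ode[OF A(1) _ T(1) this] r
      show "((\<lambda>s. s *\<^sub>R A (s *\<^sub>R \<omega>)) has_vector_derivative
              (- (A (r *\<^sub>R \<omega>) ** A (r *\<^sub>R \<omega>)) - Cmat \<Omega> X x0 c (r *\<^sub>R \<omega>) ** A (r *\<^sub>R \<omega>)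
               - Cmat \<Omega> X x0 c (r *\<^sub>R \<omega>))) (at r)"
        by (simp add: rhs_def mat_left_apply blinfun.minus_left)
    qed
    then show ?thesis using A lin by blast
  qed
  have part1: "\<exists>A. is_sol \<eta> \<Omega> X x0 c A \<and>
            (\<forall>A'. is_sol \<eta> \<Omega> X x0 c A' \<longrightarrow> (\<forall>u\<in>ball 0 \<eta>. A' u = A u)) \<and>
            (\<forall>u\<in>ball 0 \<eta>. opnorm (A u) \<le> (\<nu> * (2 * D)) * norm u) \<and>
            (\<forall>u\<in>ball 0 \<eta>. opnorm (A u) \<le> \<kappa>)"
    if set: "setting \<Omega> X d \<xi> x0 c dmin dmax ximin CX Cc"
    for \<Omega> :: "(real^'n) set" and X :: "'k \<Rightarrow> real^'n \<Rightarrow> real^'n" and d \<xi> x0 c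
  proof -
    obtain A where A: "is_sol \<eta> \<Omega> X x0 c A" "\<And>u. u \<in> ?U \<Longrightarrow> norm (A u) \<le> a"
      "\<And>u. u \<in> ?U \<Longrightarrow> norm (A u) \<le> 2 * D * norm u"
      using main[OF set] by blast
    have "opnorm (A u) \<le> (\<nu> * (2 * D)) * norm u" "opnorm (A u) \<le> \<kappa>" if "u \<in> ?U" for u
      using order_trans[OF \<nu>(2) mult_left_mono[OF A(3)[OF that] less_imp_le[OF \<nu>(1)]]]
        order_trans[OF \<nu>(2) mult_left_mono[OF A(2)[OF that] less_imp_le[OF \<nu>(1)]]] a(2)
      by (auto simp: mult.assoc)
    then show ?thesis using A(1) is_sol_unique[OF A(1) _ C(2)[OF set]] by blast
  qed
  have part2: "\<exists>Cm. \<forall>(\<Omega>::(real^'n) set) (X::'k \<Rightarrow> real^'n \<Rightarrow> real^'n) d \<xi> x0 c.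
        setting \<Omega> X d \<xi> x0 c dmin dmax ximin CX Cc \<longrightarrow>
        (\<forall>i j k. is_Cm m (ctilde \<Omega> X x0 c i j k) (ball 0 \<eta>) \<and>
                 Cm_norm_le m (ctilde \<Omega> X x0 c i j k) (ball 0 \<eta>) Ct) \<longrightarrow>
        (\<forall>A. is_sol \<eta> \<Omega> X x0 c A \<longrightarrow>
             (\<forall>i j. is_Cm m (\<lambda>u. A u $ i $ j) (ball 0 \<eta>)) \<and>
             Cm_norm_le_mat m A (ball 0 \<eta>) Cm)" for m :: nat and Ct :: real
  proof -
    define MC where "MC = (\<Sum>i\<in>(UNIV::'k set). \<Sum>k\<in>(UNIV::'k set). \<Sum>j\<in>(UNIV::'k set). 2 ^ m * (1 * max \<eta> 1 * \<bar>Ct\<bar>))"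
    define M where "M = max (K * MC) (1 * MC)"
    have "(1 / 2 :: real) < 1" by simp
    \<comment> \<open>At this point only \<open>m\<close>, \<open>Ct\<close> and the admissible data
      are fixed, so the constant \<open>N\<close> depends on nothing else.\<close>
    from ray_eq_regularity[OF this, where U = ?U and K = K and p = 0 and a = a and m = m and M = M and 'v = "real^'k^'k"]
    obtain N where N: "\<And>(b :: real^'k^'k \<Rightarrow> real^'k^'k \<Rightarrow> real^'k^'k) L l H A.
      ray_eq ?U b K L l H \<Longrightarrow> ray_eq.solves ?U b L H 0 A \<Longrightarrow> \<forall>u\<in>?U. norm (A u) \<le> a \<Longrightarrow> 4 * K * a + l \<le> 1 / 2 \<Longrightarrow>
      Ck_bound m M L ?U \<Longrightarrow> Ck_bound m M H ?U \<Longrightarrow> Ck_bound m N A ?U"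
      by blast
    have fin: "finite {\<beta> :: 'k list. length \<beta> \<le> m}"
      using finite_lists_length_le[of "UNIV :: 'k set" m] by simp
    show ?thesis
    proof (intro exI allI impI)
      fix \<Omega> :: "(real^'n) set" and X :: "'k \<Rightarrow> real^'n \<Rightarrow> real^'n" and d \<xi> x0 c A
      assume set: "setting \<Omega> X d \<xi> x0 c dmin dmax ximin CX Cc"
        and ct: "\<forall>i j k. is_Cm m (ctilde \<Omega> X x0 c i j k) ?U \<and> Cm_norm_le m (ctilde \<Omega> X x0 c i j k) ?U Ct"
        and A: "is_sol \<eta> \<Omega> X x0 c A"
      have "Ck_bound m \<bar>Ct\<bar> (ctilde \<Omega> X x0 c i j k) ?U" for i j k
      proof (rule is_Cm_imp_Ck_bound)
        show "is_Cm m (ctilde \<Omega> X x0 c i j k) ?U" using ct by blast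
        fix \<beta> :: "'k list" and u assume "length \<beta> \<le> m" "u \<in> ?U"
        then have "\<bar>pderivs \<beta> (ctilde \<Omega> X x0 c i j k) u\<bar> \<le> (\<Sum>\<beta>\<in>{\<beta>. length \<beta> \<le> m}. \<bar>pderivs \<beta> (ctilde \<Omega> X x0 c i j k) u\<bar>)"
          by (intro member_le_sum[of \<beta> _ "\<lambda>\<beta>. \<bar>pderivs \<beta> (ctilde \<Omega> X x0 c i j k) u\<bar>"] fin) auto
        also have "\<dots> \<le> Ct" using ct \<open>u \<in> ?U\<close> unfolding Cm_norm_le_def by blast
        finally show "\<bar>pderivs \<beta> (ctilde \<Omega> X x0 c i j k) u\<bar> \<le> \<bar>Ct\<bar>" by simp
      qed
      then have CM: "Ck_bound m MC (Cmat \<Omega> X x0 c) ?U"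
        unfolding MC_def by (intro Ck_bound_Cmat) auto
      obtain A0 where A0: "is_sol \<eta> \<Omega> X x0 c A0" "\<forall>u\<in>?U. norm (A0 u) \<le> a"
        "ray_eq.solves ?U ?b (\<lambda>u. - mat_left (Cmat \<Omega> X x0 c u)) (\<lambda>u. - Cmat \<Omega> X x0 c u) 0 A0"
        using main[OF set] by blast
      have "Ck_bound m N A0 ?U"
      proof (rule N[OF req[OF set] A0(3,2) q])
        have "Ck_bound m (K * MC) (\<lambda>u. - mat_left (Cmat \<Omega> X x0 c u)) ?U"
          using K(1) norm_mat_left_le[OF K] CM
          by (intro Ck_bound_linear[where T = "\<lambda>M. - mat_left M"] bounded_linear_minus bounded_linear_mat_left) auto
        then show "Ck_bound m M (\<lambda>u. - mat_left (Cmat \<Omega> X x0 c u)) ?U"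
          by (rule Ck_bound_mono) (simp add: M_def)
        have "Ck_bound m (1 * MC) (\<lambda>u. - Cmat \<Omega> X x0 c u) ?U"
          by (intro Ck_bound_linear[where T = uminus] bounded_linear_minus bounded_linear_ident CM) auto
        then show "Ck_bound m M (\<lambda>u. - Cmat \<Omega> X x0 c u) ?U"
          by (rule Ck_bound_mono) (simp add: M_def)
      qed
      \<comment> \<open>Regularity is known for the Picard solution; uniqueness on the open ball
        transfers it to an arbitrary solution.\<close>
      then have AN: "Ck_bound m N A ?U"
        using is_sol_unique[OF A A0(1) C(2)[OF set]] by (rule Ck_bound_cong[OF open_ball])
      have entry: "Ck_bound m (1 * N) (\<lambda>u. A u $ i $ j) ?U" for i j
        by (rule Ck_bound_linear[where T = "\<lambda>M. M $ i $ j", OF _ _ _ AN])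
           (auto intro!: bounded_linear_compose[OF bounded_linear_vec_nth bounded_linear_vec_nth, unfolded o_def]
             order_trans[OF component_le_norm_cart] Finite_Cartesian_Product.norm_nth_le)
      show "(\<forall>i j. is_Cm m (\<lambda>u. A u $ i $ j) ?U) \<and>
        Cm_norm_le_mat m A ?U (\<Sum>\<beta>\<in>{\<beta> :: 'k list. length \<beta> \<le> m}. \<Sum>i\<in>(UNIV :: 'k set). \<Sum>j\<in>(UNIV :: 'k set). N)"
        using Ck_bound_imp_is_Cm[OF open_ball entry] unfolding Cm_norm_le_mat_def
        by (auto intro!: sum_mono simp del: sum_constant)
    qed
  qed
  show ?thesis using \<eta>(1) part1 part2 by (intro exI[of _ \<eta>] conjI exI[of _ "\<nu> * (2 * D)"]) blast+
qed

end
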